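(* Let $m\ge3$, $n\ge2$, $0\le r_1\le m$, $0\le r_2\le n-1$. The line graph $\Lambda(C_m^{(r_1)}\times P_n^{(r_2)})$ of the Cartesian product of a signed cycle and a signed path has the eigenvalues $$\lambda_{ij}=2\Big(\cos\frac{(2i-[r_1])\pi}{m}-\cos\frac{j\pi}{n}-1\Big),\qquad 1\le i\le m,\ 1\le j\le n,$$ of which all are $<2$ except that $\lambda_{mn}=2$ when $r_1$ is even, and also the eigenvalue $2$ with additional multiplicity $m(n-1)$. The energy is $$E\big(\Lambda(C_m^{(r_1)}\times P_n^{(r_2)})\big)=2\sum_{i=1}^m\sum_{j=1}^n\Big|1-\cos\frac{(2i-[r_1])\pi}{m}+\cos\frac{j\pi}{n}\Big|+2m(n-1).$$
   Context: For an integer $r$, $[r]=0$ if $r$ is even and $[r]=1$ if $r$ is odd. A signed graph $\Sigma=(G,\sigma)$ is a finite simple graph $G=(V,E)$ with a function $\sigma:E\to\{+1,-1\}$. The adjacency matrix $A(\Sigma)$ has $(u,v)$ entry $\sigma(uv)$ if $u,v$ are adjacent and $0$ otherwise; its eigenvalues are the eigenvalues of $\Sigma$, and the energy $E(\Sigma)$ is the sum of their absolute values. The Cartesian product of signed graphs $\Sigma_i=(V_i,E_i,\sigma_i)$, $i=1,2$, is the signed graph on $V_1\times V_2$ in which $(u,v)(u',v')$ is an edge iff $v=v'$ and $uu'\in E_1$ (sign $\sigma_1(uu')$), or $u=u'$ and $vv'\in E_2$ (sign $\sigma_2(vv')$). $P_n^{(r)}$ denotes any signed path with $n$ vertices having exactly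 $r$ negative edges; $C_m^{(r)}$ denotes any signed cycle with $m$ vertices having exactly $r$ negative edges. Incidence matrix of a signed graph $\Sigma$ with $p$ vertices and $q$ edges: a $p\times q$ matrix $H(\Sigma)=[\eta_{ik}]$ with $\eta_{ik}=0$ if vertex $v_i$ is not incident with edge $e_k$, $\eta_{ik}=\pm1$ if it is, and $\eta_{ik}\eta_{jk}=-\sigma(v_iv_j)$ for each edge $e_k=v_iv_j$; unique up to multiplying columns by $-1$. Line graph: $\Lambda(\Sigma)$ is the signed graph whose underlying graph is the ordinary line graph of $G$, with signature given by $A(\Lambda(\Sigma))=2I_q-H(\Sigma)^{\mathrm T}H(\Sigma)$ (so every cycle of $\Sigma$ becomes a cycle of the same sign, and any three edges at a common vertex become a negative triangle); the choice of $H(\Sigma)$ does not affect eigenvalues. *)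

theory Defs
  imports Complex_Main "Jordan_Normal_Form.Char_Poly"
begin

text \<open>
  Finite simple graphs with a sign on each edge. Edges are two-element sets of vertices;
  the values of \<open>sg_sign\<close> outside the edge set are irrelevant.
\<close>

record 'a sgraph =
  sg_verts :: "'a set"
  sg_edges :: "'a set set"
  sg_sign :: "'a set \<Rightarrow> real"

definition signed_graph :: "'a sgraph \<Rightarrow> bool" where
  "signed_graph \<Sigma> \<longleftrightarrow> finite (sg_verts \<Sigma>)
     \<and> (\<forall>e\<in>sg_edges \<Sigma>. e \<subseteq> sg_verts \<Sigma> \<and> card e = 2)
     \<and> (\<forall>e\<in>sg_edges \<Sigma>. sg_sign \<Sigma> e \<in> {1, -1})"

definition negative_edges :: "'a sgraph \<Rightarrow> 'a set set" where
  "negative_edges \<Sigma> = {e \<in> sg_edges \<Sigma>. sg_sign \<Sigma> e = -1}"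

definition enumerates :: "'a list \<Rightarrow> 'a set \<Rightarrow> bool" where
  "enumerates xs A \<longleftrightarrow> distinct xs \<and> set xs = A"

definition adjacency_mat :: "'a sgraph \<Rightarrow> 'a list \<Rightarrow> real mat" where
  "adjacency_mat \<Sigma> vs = mat (length vs) (length vs)
     (\<lambda>(i, j). if {vs ! i, vs ! j} \<in> sg_edges \<Sigma> then sg_sign \<Sigma> {vs ! i, vs ! j} else 0)"

text \<open>
  The multiset of eigenvalues, with algebraic multiplicity. The adjacency matrix is real and
  symmetric, so taking the real roots of its characteristic polynomial loses nothing.
  The choice of the enumeration is immaterial, see \<open>eigenvalues_eq\<close> below.
\<close>

definition eigenvalues :: "'a sgraph \<Rightarrow> real multiset" where
  "eigenvalues \<Sigma> = proots (char_poly (adjacency_mat \<Sigma> (SOME vs. enumerates vs (sg_verts \<Sigma>))))"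

definition energy :: "'a sgraph \<Rightarrow> real" where
  "energy \<Sigma> = (\<Sum>x\<in>#eigenvalues \<Sigma>. \<bar>x\<bar>)"

text \<open>
  In the Cartesian product, the projection of an edge to the second component is
  a singleton for a copy of an edge of the first factor, and an edge of the second factor otherwise.
\<close>

definition cartesian_product :: "'a sgraph \<Rightarrow> 'b sgraph \<Rightarrow> ('a \<times> 'b) sgraph" where
  "cartesian_product \<Sigma>\<^sub>1 \<Sigma>\<^sub>2 =
     \<lparr> sg_verts = sg_verts \<Sigma>\<^sub>1 \<times> sg_verts \<Sigma>\<^sub>2,
       sg_edges = {{(u, v), (u', v)} | u u' v. {u, u'} \<in> sg_edges \<Sigma>\<^sub>1 \<and> v \<in> sg_verts \<Sigma>\<^sub>2}
                \<union> {{(u, v), (u, v')} | u v v'. u \<in> sg_verts \<Sigma>\<^sub>1 \<and> {v, v'} \<in> sg_edges \<Sigma>\<^sub>2},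
       sg_sign = (\<lambda>e. if is_singleton (snd ` e) then sg_sign \<Sigma>\<^sub>1 (fst ` e)
                      else sg_sign \<Sigma>\<^sub>2 (snd ` e)) \<rparr>"

definition signed_path :: "nat \<Rightarrow> nat \<Rightarrow> 'a sgraph \<Rightarrow> bool" where
  "signed_path n r \<Sigma> \<longleftrightarrow> signed_graph \<Sigma>
     \<and> (\<exists>vs. enumerates vs (sg_verts \<Sigma>) \<and> length vs = n
           \<and> sg_edges \<Sigma> = {{vs ! i, vs ! Suc i} | i. Suc i < n})
     \<and> card (negative_edges \<Sigma>) = r"

definition signed_cycle :: "nat \<Rightarrow> nat \<Rightarrow> 'a sgraph \<Rightarrow> bool" where
  "signed_cycle m r \<Sigma> \<longleftrightarrow> m \<ge> 3 \<and> signed_graph \<Sigma>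
     \<and> (\<exists>vs. enumerates vs (sg_verts \<Sigma>) \<and> length vs = m
           \<and> sg_edges \<Sigma> = {{vs ! i, vs ! (Suc i mod m)} | i. i < m})
     \<and> card (negative_edges \<Sigma>) = r"

text \<open>
  An incidence matrix, with rows indexed by the vertices and columns by the edges themselves.
\<close>

definition incidence :: "'a sgraph \<Rightarrow> ('a \<Rightarrow> 'a set \<Rightarrow> real) \<Rightarrow> bool" where
  "incidence \<Sigma> \<eta> \<longleftrightarrow>
     (\<forall>v\<in>sg_verts \<Sigma>. \<forall>e\<in>sg_edges \<Sigma>. if v \<in> e then \<eta> v e \<in> {1, -1} else \<eta> v e = 0)
     \<and> (\<forall>u v. {u, v} \<in> sg_edges \<Sigma> \<longrightarrow> \<eta> u {u, v} * \<eta> v {u, v} = - sg_sign \<Sigma> {u, v})"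

definition incidence_mat :: "('a \<Rightarrow> 'a set \<Rightarrow> real) \<Rightarrow> 'a list \<Rightarrow> 'a set list \<Rightarrow> real mat" where
  "incidence_mat \<eta> vs es = mat (length vs) (length es) (\<lambda>(i, k). \<eta> (vs ! i) (es ! k))"

text \<open>
  The signed line graph with respect to an incidence matrix. For distinct \<open>e\<close>, \<open>f\<close> the sign of
  \<open>{e, f}\<close> is the negated inner product of the columns \<open>e\<close> and \<open>f\<close>, that is, the \<open>(e, f)\<close>
  entry of \<open>2I - H\<^sup>T H\<close>; see \<open>adjacency_mat_line_graph\<close> below.
\<close>

definition line_graph :: "('a \<Rightarrow> 'a set \<Rightarrow> real) \<Rightarrow> 'a sgraph \<Rightarrow> 'a set sgraph" where
  "line_graph \<eta> \<Sigma> =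
     \<lparr> sg_verts = sg_edges \<Sigma>,
       sg_edges = {{e, f} | e f. e \<in> sg_edges \<Sigma> \<and> f \<in> sg_edges \<Sigma> \<and> e \<noteq> f \<and> e \<inter> f \<noteq> {}},
       sg_sign = (\<lambda>s. - (\<Sum>v\<in>sg_verts \<Sigma>. \<Prod>e\<in>s. \<eta> v e)) \<rparr>"

definition par :: "nat \<Rightarrow> real" where
  "par r = (if even r then 0 else 1)"

lemma adjacency_mat_similar:
  assumes "enumerates vs A" "enumerates ws A"
  shows "similar_mat (adjacency_mat \<Sigma> vs) (adjacency_mat \<Sigma> ws)"
proof -
  define n where "n = length vs"
  have d: "distinct vs" "distinct ws" "set vs = set ws"
    using assms by (auto simp: enumerates_def)
  have n2: "length ws = n"
    using d distinct_card[of vs] distinct_card[of ws] by (simp add: n_def)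
  define P :: "real mat" where "P = mat n n (\<lambda>(i, j). if vs ! i = ws ! j then 1 else 0)"
  define Q :: "real mat" where "Q = mat n n (\<lambda>(i, j). if ws ! i = vs ! j then 1 else 0)"
  have "\<exists>k<n. ws ! k = vs ! i" if "i < n" for i
    using that d(3) n2 by (metis in_set_conv_nth n_def)
  then obtain g where g: "\<And>i. i < n \<Longrightarrow> g i < n \<and> ws ! g i = vs ! i" by metis
  have "\<exists>k<n. vs ! k = ws ! i" if "i < n" for i
    using that d(3) n2 by (metis in_set_conv_nth n_def)
  then obtain h where h: "\<And>i. i < n \<Longrightarrow> h i < n \<and> vs ! h i = ws ! i" by metis
  have eqw: "ws ! j = vs ! i \<longleftrightarrow> j = g i" "vs ! i = ws ! j \<longleftrightarrow> j = g i" if "i < n" "j < n" for i j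
    using that g[OF that(1)] nth_eq_iff_index_eq[OF d(2), of j "g i"] n2 by (auto dest: sym)
  have eqv: "vs ! j = ws ! i \<longleftrightarrow> j = h i" "ws ! i = vs ! j \<longleftrightarrow> j = h i" if "i < n" "j < n" for i j
    using that h[OF that(1)] nth_eq_iff_index_eq[OF d(1), of j "h i"] by (auto simp: n_def dest: sym)
  have gi: "g i = g j \<longleftrightarrow> i = j" if "i < n" "j < n" for i j
    using that g d(1) nth_eq_iff_index_eq[of vs i j] by (metis n_def)
  have hi: "h i = h j \<longleftrightarrow> i = j" if "i < n" "j < n" for i j
    using that h d(2) n2 nth_eq_iff_index_eq[of ws i j] by metis
  have P: "P $$ (i, j) = (if j = g i then 1 else 0)" if "i < n" "j < n" for i j
    using that eqw by (simp add: P_def)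
  have P': "P $$ (i, j) = (if i = h j then 1 else 0)" if "i < n" "j < n" for i j
    using that eqv by (simp add: P_def)
  have Q: "Q $$ (i, j) = (if i = g j then 1 else 0)" if "i < n" "j < n" for i j
    using that eqw by (simp add: Q_def)
  have Q': "Q $$ (i, j) = (if j = h i then 1 else 0)" if "i < n" "j < n" for i j
    using that eqv by (simp add: Q_def)
  have car: "P \<in> carrier_mat n n" "Q \<in> carrier_mat n n"
    "adjacency_mat \<Sigma> ws \<in> carrier_mat n n" "adjacency_mat \<Sigma> vs \<in> carrier_mat n n"
    by (simp_all add: P_def Q_def adjacency_mat_def n2 n_def)
  have mult: "(M * N) $$ (i, j) = (\<Sum>k<n. M $$ (i, k) * N $$ (k, j))"
    if "M \<in> carrier_mat n n" "N \<in> carrier_mat n n" "i < n" "j < n" for M N :: "real mat" and i j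
    using that by (simp add: scalar_prod_def atLeast0LessThan)
  have PQ: "P * Q = 1\<^sub>m n"
  proof (rule eq_matI)
    fix i j assume ij: "i < dim_row (1\<^sub>m n :: real mat)" "j < dim_col (1\<^sub>m n :: real mat)"
    then have "(P * Q) $$ (i, j) = (\<Sum>k<n. if k = g i then (if k = g j then 1 else 0) else 0)"
      by (subst mult[OF car(1,2)]) (simp, simp, rule sum.cong, simp_all add: P Q)
    also have "\<dots> = (1\<^sub>m n :: real mat) $$ (i, j)"
      using ij g gi by simp
    finally show "(P * Q) $$ (i, j) = (1\<^sub>m n :: real mat) $$ (i, j)" .
  qed (use car in auto)
  have QP: "Q * P = 1\<^sub>m n"
  proof (rule eq_matI)
    fix i j assume ij: "i < dim_row (1\<^sub>m n :: real mat)" "j < dim_col (1\<^sub>m n :: real mat)"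
    then have "(Q * P) $$ (i, j) = (\<Sum>k<n. if k = h i then (if k = h j then 1 else 0) else 0)"
      by (subst mult[OF car(2,1)]) (simp, simp, rule sum.cong, simp_all add: P' Q')
    also have "\<dots> = (1\<^sub>m n :: real mat) $$ (i, j)"
      using ij h hi by simp
    finally show "(Q * P) $$ (i, j) = (1\<^sub>m n :: real mat) $$ (i, j)" .
  qed (use car in auto)
  have "adjacency_mat \<Sigma> vs = P * adjacency_mat \<Sigma> ws * Q"
  proof (rule eq_matI)
    fix i j
    assume "i < dim_row (P * adjacency_mat \<Sigma> ws * Q)" "j < dim_col (P * adjacency_mat \<Sigma> ws * Q)"
    then have ij: "i < n" "j < n" using car by auto
    have B: "(P * adjacency_mat \<Sigma> ws) $$ (i, k) = adjacency_mat \<Sigma> ws $$ (g i, k)" if "k < n" for k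
    proof -
      have "(P * adjacency_mat \<Sigma> ws) $$ (i, k)
          = (\<Sum>l<n. if l = g i then adjacency_mat \<Sigma> ws $$ (l, k) else 0)"
        using ij that by (subst mult[OF car(1,3)]) (simp, simp, rule sum.cong, simp_all add: P)
      also have "\<dots> = adjacency_mat \<Sigma> ws $$ (g i, k)" using ij g by simp
      finally show ?thesis .
    qed
    have "(P * adjacency_mat \<Sigma> ws * Q) $$ (i, j)
        = (\<Sum>k<n. if k = g j then adjacency_mat \<Sigma> ws $$ (g i, k) else 0)"
      using ij by (subst mult[OF mult_carrier_mat[OF car(1,3)] car(2)])
        (simp, simp, rule sum.cong, simp_all add: Q B del: index_mult_mat)
    also have "\<dots> = adjacency_mat \<Sigma> ws $$ (g i, g j)" using ij g by simp
    also have "\<dots> = adjacency_mat \<Sigma> vs $$ (i, j)"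
      using ij g[of i] g[of j] n2 by (simp add: adjacency_mat_def n_def)
    finally show "adjacency_mat \<Sigma> vs $$ (i, j) = (P * adjacency_mat \<Sigma> ws * Q) $$ (i, j)" by simp
  qed (use car in auto)
  then show ?thesis
    using similar_matI[of "adjacency_mat \<Sigma> vs" "adjacency_mat \<Sigma> ws" P Q n] car PQ QP by simp
qed

lemma eigenvalues_eq:
  assumes "enumerates vs (sg_verts \<Sigma>)"
  shows "eigenvalues \<Sigma> = proots (char_poly (adjacency_mat \<Sigma> vs))"
proof -
  have "enumerates (SOME vs. enumerates vs (sg_verts \<Sigma>)) (sg_verts \<Sigma>)"
    using assms by (rule someI)
  from char_poly_similar[OF adjacency_mat_similar[OF this assms]] show ?thesis
    unfolding eigenvalues_def by simp
qed

lemma incidence_exists: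
  assumes "signed_graph \<Sigma>"
  shows "\<exists>\<eta>. incidence \<Sigma> \<eta>"
proof -
  define p where "p e = (SOME u. u \<in> e)" for e :: "'a set"
  define \<eta> where "\<eta> v e = (if v \<notin> e then 0 else if v = p e then 1 else - sg_sign \<Sigma> e)" for v e
  have "\<eta> u {u, v} * \<eta> v {u, v} = - sg_sign \<Sigma> {u, v}" if e: "{u, v} \<in> sg_edges \<Sigma>" for u v
  proof -
    have "card {u, v} = 2" using assms e by (auto simp: signed_graph_def)
    then have "u \<noteq> v" by auto
    moreover have "p {u, v} \<in> {u, v}" unfolding p_def by (rule someI[of _ u]) simp
    ultimately show ?thesis by (auto simp: \<eta>_def)
  qed
  then have "incidence \<Sigma> \<eta>"
    using assms by (auto simp: incidence_def \<eta>_def signed_graph_def)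
  then show ?thesis by blast
qed

lemma adjacency_mat_line_graph:
  assumes S: "signed_graph \<Sigma>" and I: "incidence \<Sigma> \<eta>"
    and vs: "enumerates vs (sg_verts \<Sigma>)" and es: "enumerates es (sg_edges \<Sigma>)"
  shows "adjacency_mat (line_graph \<eta> \<Sigma>) es
    = 2 \<cdot>\<^sub>m 1\<^sub>m (length es) - (incidence_mat \<eta> vs es)\<^sup>T * incidence_mat \<eta> vs es"
proof (rule eq_matI)
  let ?H = "incidence_mat \<eta> vs es"
  fix i j
  assume "i < dim_row (2 \<cdot>\<^sub>m 1\<^sub>m (length es) - ?H\<^sup>T * ?H)"
    "j < dim_col (2 \<cdot>\<^sub>m 1\<^sub>m (length es) - ?H\<^sup>T * ?H)"
  then have ij: "i < length es" "j < length es" by (auto simp: incidence_mat_def)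
  let ?e = "es ! i" and ?f = "es ! j"
  have ef: "?e \<in> sg_edges \<Sigma>" "?f \<in> sg_edges \<Sigma>" using ij es nth_mem unfolding enumerates_def by metis+
  have fin: "finite (sg_verts \<Sigma>)" using S by (simp add: signed_graph_def)
  have "(?H\<^sup>T * ?H) $$ (i, j) = (\<Sum>k<length vs. \<eta> (vs ! k) ?e * \<eta> (vs ! k) ?f)"
    using ij by (simp add: incidence_mat_def scalar_prod_def atLeast0LessThan)
  also have "\<dots> = (\<Sum>v\<in>sg_verts \<Sigma>. \<eta> v ?e * \<eta> v ?f)"
    using vs by (intro sum.reindex_bij_betw bij_betw_nth) (auto simp: enumerates_def)
  finally have HH: "(?H\<^sup>T * ?H) $$ (i, j) = (\<Sum>v\<in>sg_verts \<Sigma>. \<eta> v ?e * \<eta> v ?f)" .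
  have val: "if v \<in> e then \<eta> v e \<in> {1, -1} else \<eta> v e = 0"
    if "v \<in> sg_verts \<Sigma>" "e \<in> sg_edges \<Sigma>" for v e
    using I that unfolding incidence_def by blast
  have rhs: "(2 \<cdot>\<^sub>m 1\<^sub>m (length es) - ?H\<^sup>T * ?H) $$ (i, j)
      = (if i = j then 2 else 0) - (?H\<^sup>T * ?H) $$ (i, j)"
    using ij by (simp add: incidence_mat_def)
  show "adjacency_mat (line_graph \<eta> \<Sigma>) es $$ (i, j) = (2 \<cdot>\<^sub>m 1\<^sub>m (length es) - ?H\<^sup>T * ?H) $$ (i, j)"
  proof (cases "i = j")
    case True
    have sub: "?e \<subseteq> sg_verts \<Sigma>" "card ?e = 2" using S ef by (auto simp: signed_graph_def)
    have "(\<Sum>v\<in>sg_verts \<Sigma>. \<eta> v ?e * \<eta> v ?f) = (\<Sum>v\<in>sg_verts \<Sigma>. if v \<in> ?e then 1 else 0)"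
      using val[OF _ ef(1)] True by (intro sum.cong) (fastforce split: if_splits)+
    also have "\<dots> = 2" using sub fin by (simp add: sum.If_cases Int_absorb1)
    finally have "(2 \<cdot>\<^sub>m 1\<^sub>m (length es) - ?H\<^sup>T * ?H) $$ (i, j) = 0"
      unfolding rhs HH using True by simp
    moreover have "adjacency_mat (line_graph \<eta> \<Sigma>) es $$ (i, j) = 0"
      using ij True by (auto simp: adjacency_mat_def line_graph_def doubleton_eq_iff)
    ultimately show ?thesis by simp
  next
    case False
    then have ne: "?e \<noteq> ?f" using ij es by (auto simp: enumerates_def nth_eq_iff_index_eq)
    have prod: "(\<Prod>e\<in>{?e, ?f}. \<eta> v e) = \<eta> v ?e * \<eta> v ?f" for v using ne by simp
    have adj: "{?e, ?f} \<in> sg_edges (line_graph \<eta> \<Sigma>) \<longleftrightarrow> ?e \<inter> ?f \<noteq> {}"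
      using ef ne by (auto simp: line_graph_def doubleton_eq_iff)
    have "?e \<inter> ?f = {} \<Longrightarrow> (\<Sum>v\<in>sg_verts \<Sigma>. \<eta> v ?e * \<eta> v ?f) = 0"
      using val[OF _ ef(1)] val[OF _ ef(2)] by (intro sum.neutral) (fastforce split: if_splits)
    then show ?thesis
      using ij False unfolding rhs HH
      by (simp add: adjacency_mat_def adj) (simp add: line_graph_def prod)
  qed
qed (auto simp: adjacency_mat_def incidence_mat_def)

lemma signed_graph_cartesian_product:
  assumes "signed_graph \<Sigma>\<^sub>1" "signed_graph \<Sigma>\<^sub>2"
  shows "signed_graph (cartesian_product \<Sigma>\<^sub>1 \<Sigma>\<^sub>2)"
proof -
  let ?S = "cartesian_product \<Sigma>\<^sub>1 \<Sigma>\<^sub>2"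
  have A: "e \<subseteq> sg_verts ?S \<and> card e = 2 \<and> sg_sign ?S e \<in> {1, -1}" if "e \<in> sg_edges ?S" for e
  proof -
    from that consider
        (1) u u' v where "e = {(u, v), (u', v)}" "{u, u'} \<in> sg_edges \<Sigma>\<^sub>1" "v \<in> sg_verts \<Sigma>\<^sub>2"
      | (2) u v v' where "e = {(u, v), (u, v')}" "u \<in> sg_verts \<Sigma>\<^sub>1" "{v, v'} \<in> sg_edges \<Sigma>\<^sub>2"
      unfolding cartesian_product_def by auto
    then show ?thesis
    proof cases
      case 1
      then have h: "{u, u'} \<subseteq> sg_verts \<Sigma>\<^sub>1" "card {u, u'} = 2" "sg_sign \<Sigma>\<^sub>1 {u, u'} \<in> {1, -1}"
        using assms(1) unfolding signed_graph_def by blast+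
      then have "u \<noteq> u'" by auto
      with h 1 show ?thesis by (simp add: cartesian_product_def)
    next
      case 2
      then have h: "{v, v'} \<subseteq> sg_verts \<Sigma>\<^sub>2" "card {v, v'} = 2" "sg_sign \<Sigma>\<^sub>2 {v, v'} \<in> {1, -1}"
        using assms(2) unfolding signed_graph_def by blast+
      then have "v \<noteq> v'" by auto
      with h 2 show ?thesis by (simp add: cartesian_product_def is_singleton_altdef)
    qed
  qed
  moreover have "finite (sg_verts ?S)"
    using assms by (simp add: cartesian_product_def signed_graph_def)
  ultimately show ?thesis unfolding signed_graph_def by blast
qed

end

theory Submission
  imports Defs
begin

text \<open>
  For an incidence matrix \<open>H\<close> the matrix \<open>H H\<^sup>T\<close> is the signed Laplacian, and \<open>H\<^sup>T H\<close> has the same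
  eigenvalues up to additional zeros; hence \<open>2I - H\<^sup>T H\<close> has the eigenvalues \<open>2 - \<mu>\<close>, with \<open>\<mu>\<close>
  running over the Laplacian spectrum, and the eigenvalue \<open>2\<close> once for every edge in excess of the
  number of vertices. The Laplacian spectrum of a Cartesian product consists of the sums of those of
  the factors. After switching, the Laplacian of a signed path is diagonalised by the vectors
  \<open>cos (\<theta> (2k + 1))\<close> with \<open>2n\<theta> \<in> \<pi>\<int>\<close>, and that of a signed cycle by the vectors
  \<open>cos (\<theta> k) + sin (\<theta> k)\<close>, which have to be periodic or antiperiodic modulo \<open>m\<close> according to the
  parity of the number of negative edges.
\<close>

subsection \<open>Characteristic polynomials\<close>

text \<open>The homogeneous form of the Weinstein-Aronszajn (Sylvester) identity. Keeping the powers
  of \<open>x\<close> as factors avoids any division, so \<open>x = 0\<close> is covered.\<close>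

lemma det_add_mult_commute:
  fixes A B :: "'a::idom mat"
  assumes A: "A \<in> carrier_mat p q" and B: "B \<in> carrier_mat q p"
  shows "x ^ q * det (x \<cdot>\<^sub>m 1\<^sub>m p + A * B) = x ^ p * det (x \<cdot>\<^sub>m 1\<^sub>m q + B * A)"
proof -
  \<comment> \<open>\<open>?R\<close> clears the lower left block of \<open>?M\<close> from the right, \<open>?L\<close> from the left.\<close>
  let ?M = "four_block_mat (x \<cdot>\<^sub>m 1\<^sub>m p) (- A) B (1\<^sub>m q)"
  let ?L = "four_block_mat (1\<^sub>m p) (0\<^sub>m p q) (- B) (x \<cdot>\<^sub>m 1\<^sub>m q)"
  let ?R = "four_block_mat (1\<^sub>m p) (0\<^sub>m p q) (- B) (1\<^sub>m q)"
  have car: "?M \<in> carrier_mat (p + q) (p + q)" "?L \<in> carrier_mat (p + q) (p + q)"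
    "?R \<in> carrier_mat (p + q) (p + q)"
    using A B by (auto intro!: four_block_carrier_mat)
  have "?M * ?R = four_block_mat (x \<cdot>\<^sub>m 1\<^sub>m p + A * B) (- A) (0\<^sub>m q p) (1\<^sub>m q)"
    using A B by (subst mult_four_block_mat[where ?n1.0 = p and ?n2.0 = q and ?nr1.0 = p and ?nr2.0 = q
          and ?nc1.0 = p and ?nc2.0 = q])
       (auto simp: uminus_l_inv_mat[OF B] intro!: cong_four_block_mat)
  then have "det ?M * det ?R = det (x \<cdot>\<^sub>m 1\<^sub>m p + A * B)"
    using A B det_mult[OF car(1,3)]
    by (simp add: det_four_block_mat_lower_left_zero[where n = p and m = q])
  moreover have "det ?R = 1"
    using B by (subst det_four_block_mat_upper_right_zero[where n = p and m = q]) auto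
  ultimately have M: "det ?M = det (x \<cdot>\<^sub>m 1\<^sub>m p + A * B)" by simp
  have "?L * ?M = four_block_mat (x \<cdot>\<^sub>m 1\<^sub>m p) (- A) (0\<^sub>m q p) (x \<cdot>\<^sub>m 1\<^sub>m q + B * A)"
    using A B
    by (subst mult_four_block_mat[where ?n1.0 = p and ?n2.0 = q and ?nr1.0 = p and ?nr2.0 = q
          and ?nc1.0 = p and ?nc2.0 = q])
       (auto simp: mult_smult_distrib[of _ q p _ p] mult_smult_assoc_mat[of _ q q _ p] 
           uminus_l_inv_mat comm_add_mat[of _ q q] intro!: cong_four_block_mat)
  then have "det ?L * det ?M = x ^ p * det (x \<cdot>\<^sub>m 1\<^sub>m q + B * A)"
    using A B det_mult[OF car(2,1)]
    by (simp add: det_four_block_mat_lower_left_zero[where n = p and m = q])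
  moreover have "det ?L = x ^ q"
    using B by (subst det_four_block_mat_upper_right_zero[where n = p and m = q]) auto
  ultimately show ?thesis using M by simp
qed

text \<open>At \<open>x\<close> the characteristic polynomial of \<open>cI - M\<close> takes the
  value \<open>det ((x - c)I + M)\<close>, so this is the determinant identity at
  \<open>x - c\<close>. Real polynomials that agree at every point are equal.\<close>

lemma char_poly_diff_mult_commute:
  fixes A B :: "real mat"
  assumes A: "A \<in> carrier_mat p q" and B: "B \<in> carrier_mat q p"
  shows "[:-c, 1:] ^ q * char_poly (c \<cdot>\<^sub>m 1\<^sub>m p - A * B)
    = [:-c, 1:] ^ p * char_poly (c \<cdot>\<^sub>m 1\<^sub>m q - B * A)"
proof (rule poly_ext)
  fix x
  have eval: "poly (char_poly (c \<cdot>\<^sub>m 1\<^sub>m k - M)) x = det ((x - c) \<cdot>\<^sub>m 1\<^sub>m k + M)"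
    if "M \<in> carrier_mat k k" for k and M :: "real mat"
  proof -
    have "c \<cdot>\<^sub>m 1\<^sub>m k - M \<in> carrier_mat k k" using that by auto
    moreover have "- char_matrix (c \<cdot>\<^sub>m 1\<^sub>m k - M) x = (x - c) \<cdot>\<^sub>m 1\<^sub>m k + M"
      using that by (intro eq_matI) (auto simp: char_matrix_def)
    ultimately show ?thesis by (metis char_poly_matrix)
  qed
  show "poly ([:-c, 1:] ^ q * char_poly (c \<cdot>\<^sub>m 1\<^sub>m p - A * B)) x
      = poly ([:-c, 1:] ^ p * char_poly (c \<cdot>\<^sub>m 1\<^sub>m q - B * A)) x"
    using det_add_mult_commute[OF assms, of "x - c"] A B by (simp add: eval)
qed

text \<open>The columns of \<open>U\<close> form a basis of eigenvectors, so \<open>U\<close>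
  conjugates \<open>M\<close> to a diagonal matrix.\<close>

lemma char_poly_eigenbasis:
  fixes M U :: "'a::field mat"
  assumes M: "M \<in> carrier_mat n n" and U: "U \<in> carrier_mat n n" and det: "det U \<noteq> 0"
    and eig: "M * U = U * mat_diag n d"
  shows "char_poly M = (\<Prod>i<n. [:- d i, 1:])"
proof -
  obtain V where V: "V \<in> carrier_mat n n" "U * V = 1\<^sub>m n" "V * U = 1\<^sub>m n"
    using det_non_zero_imp_unit[OF U det] by (auto simp: Units_def ring_mat_simps)
  have "M = M * (U * V)" using M V by simp
  also have "\<dots> = U * mat_diag n d * V" using M U V(1) eig by (metis assoc_mult_mat)
  finally have "similar_mat M (mat_diag n d)"
    using similar_matI[of M "mat_diag n d" U V n] M U V by simp
  then have "char_poly M = char_poly (mat_diag n d)" by (rule char_poly_similar)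
  also have "\<dots> = (\<Prod>a\<leftarrow>diag_mat (mat_diag n d). [:- a, 1:])"
    by (rule char_poly_upper_triangular[of _ n]) (auto simp: mat_diag_def)
  also have "diag_mat (mat_diag n d) = map d [0..<n]"
    by (auto simp: diag_mat_def mat_diag_def)
  also have "(\<Prod>a\<leftarrow>map d [0..<n]. [:- a, 1:]) = (\<Prod>i<n. [:- d i, 1:])"
    by (simp add: prod.distinct_set_conv_list[symmetric] comp_def atLeast0LessThan)
  finally show ?thesis .
qed

text \<open>The functions \<open>f t\<close> become the columns of a square matrix \<open>U\<close>.
  Orthogonality makes the Gram matrix \<open>U\<^sup>T * U\<close> diagonal with nonzero entries,
  hence \<open>U\<close> is invertible. The values \<open>d t\<close> may coincide, so
  multiplicities come out right.\<close>

lemma char_poly_orthogonal_eigenfunctions: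
  fixes K :: "'v \<Rightarrow> 'v \<Rightarrow> real"
  assumes vs: "enumerates vs V" and T: "finite T" "card T = card V"
    and eig: "\<And>t u. t \<in> T \<Longrightarrow> u \<in> V \<Longrightarrow> (\<Sum>v\<in>V. K u v * f t v) = d t * f t u"
    and orth: "\<And>s t. s \<in> T \<Longrightarrow> t \<in> T \<Longrightarrow> s \<noteq> t \<Longrightarrow> (\<Sum>v\<in>V. f s v * f t v) = 0"
    and nz: "\<And>t. t \<in> T \<Longrightarrow> (\<Sum>v\<in>V. f t v * f t v) \<noteq> 0"
  shows "char_poly (mat (length vs) (length vs) (\<lambda>(i, j). K (vs ! i) (vs ! j))) = (\<Prod>t\<in>T. [:- d t, 1:])"
proof -
  define n where "n = length vs"
  have dvs: "distinct vs" "set vs = V" using vs by (auto simp: enumerates_def)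
  have sumV: "(\<Sum>k = 0..<n. g (vs ! k)) = (\<Sum>v\<in>V. g v)" for g :: "'v \<Rightarrow> real"
    unfolding atLeast0LessThan using dvs by (intro sum.reindex_bij_betw bij_betw_nth) (auto simp: n_def)
  obtain ts where ts: "distinct ts" "set ts = T" using finite_distinct_list[OF T(1)] by blast
  have len: "length ts = n" using ts dvs T(2) distinct_card[of vs] distinct_card[of ts] by (simp add: n_def)
  have tsT: "ts ! i \<in> T" if "i < n" for i using that ts len nth_mem by metis
  have vsV: "vs ! i \<in> V" if "i < n" for i using that dvs nth_mem n_def by metis
  define M where "M = mat n n (\<lambda>(i, j). K (vs ! i) (vs ! j))"
  define U where "U = mat n n (\<lambda>(i, j). f (ts ! j) (vs ! i))"
  have car: "M \<in> carrier_mat n n" "U \<in> carrier_mat n n" by (auto simp: M_def U_def)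
  have "M * U = U * mat_diag n (\<lambda>i. d (ts ! i))"
  proof (subst mat_diag_mult_right[OF car(2)], rule eq_matI, goal_cases)
    case (1 i j)
    then show ?case
      using sumV[of "\<lambda>v. K (vs ! i) v * f (ts ! j) v"]
      by (simp add: M_def U_def scalar_prod_def eig tsT vsV)
  qed (auto simp: M_def U_def)
  moreover have "det U \<noteq> 0"
  proof -
    have "U\<^sup>T * U = mat_diag n (\<lambda>i. \<Sum>v\<in>V. f (ts ! i) v * f (ts ! i) v)"
    proof (rule eq_matI, goal_cases)
      case (1 i j)
      then have ij: "i < n" "j < n" by (auto simp: mat_diag_def)
      then have "ts ! i = ts ! j \<longleftrightarrow> i = j" using ts(1) len by (simp add: nth_eq_iff_index_eq)
      with ij show ?case
        using sumV[of "\<lambda>v. f (ts ! i) v * f (ts ! j) v"] orth[of "ts ! i" "ts ! j"] tsT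
        by (simp add: U_def mat_diag_def scalar_prod_def)
    qed (auto simp: U_def mat_diag_def)
    then have "det U * det U = det (mat_diag n (\<lambda>i. \<Sum>v\<in>V. f (ts ! i) v * f (ts ! i) v))"
      using car det_mult[of "U\<^sup>T" n U] by (simp add: det_transpose)
    also have "\<dots> = prod_list (diag_mat (mat_diag n (\<lambda>i. \<Sum>v\<in>V. f (ts ! i) v * f (ts ! i) v)))"
      by (rule det_upper_triangular[of _ n]) (auto simp: mat_diag_def)
    also have "\<dots> \<noteq> 0"
      using nz tsT by (auto simp: diag_mat_def mat_diag_def)
    finally show ?thesis by auto
  qed
  ultimately have "char_poly M = (\<Prod>i<n. [:- d (ts ! i), 1:])"
    using char_poly_eigenbasis car by blast
  also have "\<dots> = (\<Prod>t\<in>T. [:- d t, 1:])"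
    using ts len by (intro prod.reindex_bij_betw bij_betw_nth) auto
  finally show ?thesis by (simp add: M_def n_def)
qed

subsection \<open>Laplacians and line graphs\<close>

text \<open>The signed Laplacian, degree matrix minus adjacency matrix, as an operator on functions:
  no enumeration of the vertices enters, and the degree term is spread over the neighbours.\<close>

definition laplacian :: "'a sgraph \<Rightarrow> ('a \<Rightarrow> real) \<Rightarrow> 'a \<Rightarrow> real" where
  "laplacian \<Sigma> f u = (\<Sum>w | {u, w} \<in> sg_edges \<Sigma>. f u - sg_sign \<Sigma> {u, w} * f w)"

lemma signed_graph_edgeD:
  assumes "signed_graph \<Sigma>" "{u, w} \<in> sg_edges \<Sigma>"
  shows "u \<in> sg_verts \<Sigma>" "w \<in> sg_verts \<Sigma>" "u \<noteq> w"
proof -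
  have "{u, w} \<subseteq> sg_verts \<Sigma>" "card {u, w} = 2"
    using assms unfolding signed_graph_def by blast+
  then show "u \<in> sg_verts \<Sigma>" "w \<in> sg_verts \<Sigma>" "u \<noteq> w" by auto
qed

lemma signed_graph_edge_doubleton:
  assumes "signed_graph \<Sigma>" "e \<in> sg_edges \<Sigma>"
  shows "\<exists>u w. e = {u, w}"
proof -
  have "card e = 2" using assms by (simp add: signed_graph_def)
  then show ?thesis by (auto simp: card_2_iff)
qed

lemma finite_sg_edges:
  assumes "signed_graph \<Sigma>"
  shows "finite (sg_edges \<Sigma>)"
  using assms unfolding signed_graph_def by (blast intro: finite_subset[of _ "Pow (sg_verts \<Sigma>)"])

text \<open>This is \<open>H H\<^sup>T = D - A\<close>. In the sum over \<open>v\<close> only the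
  two endpoints of an edge \<open>{u, w}\<close> survive; the square of an entry is 1 and the mixed
  product is minus the sign, so each edge at \<open>u\<close> gives one summand of the
  Laplacian.\<close>

lemma incidence_laplacian:
  assumes S: "signed_graph \<Sigma>" and I: "incidence \<Sigma> \<eta>" and u: "u \<in> sg_verts \<Sigma>"
  shows "(\<Sum>v\<in>sg_verts \<Sigma>. (\<Sum>e\<in>sg_edges \<Sigma>. \<eta> u e * \<eta> v e) * f v) = laplacian \<Sigma> f u"
proof -
  let ?V = "sg_verts \<Sigma>" and ?E = "sg_edges \<Sigma>"
  have fin: "finite ?V" "finite ?E" using S finite_sg_edges by (auto simp: signed_graph_def)
  have val: "if v \<in> e then \<eta> v e \<in> {1, -1} else \<eta> v e = 0" if "v \<in> ?V" "e \<in> ?E" for v e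
    using I that unfolding incidence_def by blast
  have edge: "\<eta> u e * (\<Sum>v\<in>?V. \<eta> v e * f v) = f u - sg_sign \<Sigma> e * f w"
    if e: "e \<in> ?E" "e = {u, w}" for e w
  proof -
    have uw: "w \<in> ?V" "u \<noteq> w" using signed_graph_edgeD[OF S] e by auto
    have "(\<Sum>v\<in>?V. \<eta> v e * f v) = (\<Sum>v\<in>{u, w}. \<eta> v e * f v)"
      using fin u uw(1) val[OF _ e(1)] e(2) by (intro sum.mono_neutral_right) auto
    also have "\<dots> = \<eta> u e * f u + \<eta> w e * f w" using uw by simp
    finally have "\<eta> u e * (\<Sum>v\<in>?V. \<eta> v e * f v)
        = \<eta> u e * \<eta> u e * f u + \<eta> u e * \<eta> w e * f w"
      by (simp add: algebra_simps)
    moreover have "\<eta> u e * \<eta> u e = 1" using val[OF u e(1)] e(2) by auto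
    moreover have "\<eta> u e * \<eta> w e = - sg_sign \<Sigma> e" using I e unfolding incidence_def by blast
    ultimately show ?thesis by simp
  qed
  have bij: "bij_betw (\<lambda>w. {u, w}) {w. {u, w} \<in> ?E} {e \<in> ?E. u \<in> e}"
  proof (rule bij_betw_imageI)
    show "inj_on (\<lambda>w. {u, w}) {w. {u, w} \<in> ?E}" by (auto simp: inj_on_def doubleton_eq_iff)
    have "\<exists>w. e = {u, w}" if e: "e \<in> ?E" "u \<in> e" for e
    proof -
      obtain a b where "e = {a, b}" using signed_graph_edge_doubleton[OF S e(1)] by blast
      with e(2) show ?thesis by auto
    qed
    then show "(\<lambda>w. {u, w}) ` {w. {u, w} \<in> ?E} = {e \<in> ?E. u \<in> e}" by auto
  qed
  have "(\<Sum>v\<in>?V. (\<Sum>e\<in>?E. \<eta> u e * \<eta> v e) * f v) = (\<Sum>e\<in>?E. \<eta> u e * (\<Sum>v\<in>?V. \<eta> v e * f v))"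
    unfolding sum_distrib_right sum_distrib_left by (subst sum.swap) (simp add: mult_ac)
  also have "\<dots> = (\<Sum>e\<in>{e \<in> ?E. u \<in> e}. \<eta> u e * (\<Sum>v\<in>?V. \<eta> v e * f v))"
    using fin val[OF u] by (intro sum.mono_neutral_right) auto
  also have "\<dots> = (\<Sum>w | {u, w} \<in> ?E. \<eta> u {u, w} * (\<Sum>v\<in>?V. \<eta> v {u, w} * f v))"
    by (rule sum.reindex_bij_betw[OF bij, symmetric])
  also have "\<dots> = laplacian \<Sigma> f u"
    unfolding laplacian_def by (rule sum.cong) (auto intro!: edge)
  finally show ?thesis .
qed

lemma proots_prod_linear: "finite T \<Longrightarrow> proots (\<Prod>t\<in>T. [:- a t, 1::real:]) = {#a t. t \<in># mset_set T#}"
  by (subst proots_prod) (auto simp: sum_unfold_sum_mset)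

text \<open>The index type is arbitrary so that a product of bases can be indexed by pairs. The
  equivalence in the last conjunct encodes orthogonality for \<open>s \<noteq> t\<close> and a
  nonzero norm for \<open>s = t\<close>.\<close>

definition laplacian_eigenbasis ::
    "'a sgraph \<Rightarrow> 't set \<Rightarrow> ('t \<Rightarrow> real) \<Rightarrow> ('t \<Rightarrow> 'a \<Rightarrow> real) \<Rightarrow> bool" where
  "laplacian_eigenbasis \<Sigma> T d f \<longleftrightarrow> finite T \<and> card T = card (sg_verts \<Sigma>)
     \<and> (\<forall>t\<in>T. \<forall>u\<in>sg_verts \<Sigma>. laplacian \<Sigma> (f t) u = d t * f t u)
     \<and> (\<forall>s\<in>T. \<forall>t\<in>T. (\<Sum>v\<in>sg_verts \<Sigma>. f s v * f t v) = 0 \<longleftrightarrow> s \<noteq> t)"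

text \<open>The basis diagonalises \<open>2I - H H\<^sup>T\<close>. Passing to
  \<open>2I - H\<^sup>T H\<close>, whose size is larger by \<open>k\<close>, multiplies the
  characteristic polynomial by the \<open>k\<close>-th power of \<open>X - 2\<close>.\<close>

lemma eigenvalues_line_graph:
  assumes S: "signed_graph \<Sigma>" and I: "incidence \<Sigma> \<eta>" and B: "laplacian_eigenbasis \<Sigma> T d f"
    and card: "card (sg_edges \<Sigma>) = card (sg_verts \<Sigma>) + k"
  shows "eigenvalues (line_graph \<eta> \<Sigma>) = {#2 - d t. t \<in># mset_set T#} + replicate_mset k 2"
proof -
  let ?V = "sg_verts \<Sigma>" and ?E = "sg_edges \<Sigma>"
  have fin: "finite ?V" "finite ?E" using S finite_sg_edges by (auto simp: signed_graph_def)
  have T: "finite T" "card T = card ?V"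
    and eig: "\<And>t u. t \<in> T \<Longrightarrow> u \<in> ?V \<Longrightarrow> laplacian \<Sigma> (f t) u = d t * f t u"
    and orth: "\<And>s t. s \<in> T \<Longrightarrow> t \<in> T \<Longrightarrow> s \<noteq> t \<Longrightarrow> (\<Sum>v\<in>?V. f s v * f t v) = 0"
    and nz: "\<And>t. t \<in> T \<Longrightarrow> (\<Sum>v\<in>?V. f t v * f t v) \<noteq> 0"
    using B unfolding laplacian_eigenbasis_def by auto
  obtain vs es where vs: "enumerates vs ?V" and es: "enumerates es ?E"
    using fin finite_distinct_list unfolding enumerates_def by metis
  define p q where "p = length vs" and "q = length es"
  have pq: "q = p + k"
    using card vs es distinct_card[of vs] distinct_card[of es] by (simp add: p_def q_def enumerates_def)
  let ?H = "incidence_mat \<eta> vs es"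
  have H: "?H \<in> carrier_mat p q" by (simp add: incidence_mat_def p_def q_def)
  have ev: "eigenvalues (line_graph \<eta> \<Sigma>) = proots (char_poly (2 \<cdot>\<^sub>m 1\<^sub>m q - ?H\<^sup>T * ?H))"
    using eigenvalues_eq[of es "line_graph \<eta> \<Sigma>"] es adjacency_mat_line_graph[OF S I vs es]
    by (simp add: line_graph_def q_def)
  \<comment> \<open>The kernel of \<open>2I - H H\<^sup>T\<close>; by
    \<open>incidence_laplacian\<close> it acts as 2 minus the Laplacian.\<close>
  let ?K = "\<lambda>u v. (if u = v then 2 else 0) - (\<Sum>e\<in>?E. \<eta> u e * \<eta> v e)"
  have HHt: "2 \<cdot>\<^sub>m 1\<^sub>m p - ?H * ?H\<^sup>T = mat p p (\<lambda>(i, j). ?K (vs ! i) (vs ! j))"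
  proof (rule eq_matI)
    fix i j assume "i < dim_row (mat p p (\<lambda>(i, j). ?K (vs ! i) (vs ! j)))"
      "j < dim_col (mat p p (\<lambda>(i, j). ?K (vs ! i) (vs ! j)))"
    then have ij: "i < p" "j < p" by auto
    have "(\<Sum>l = 0..<q. \<eta> (vs ! i) (es ! l) * \<eta> (vs ! j) (es ! l)) = (\<Sum>e\<in>?E. \<eta> (vs ! i) e * \<eta> (vs ! j) e)"
      unfolding atLeast0LessThan using es
      by (intro sum.reindex_bij_betw[where g = "\<lambda>e. \<eta> (vs ! i) e * \<eta> (vs ! j) e"] bij_betw_nth)
         (auto simp: q_def enumerates_def)
    moreover have "vs ! i = vs ! j \<longleftrightarrow> i = j"
      using vs ij by (simp add: enumerates_def nth_eq_iff_index_eq p_def)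
    ultimately show "(2 \<cdot>\<^sub>m 1\<^sub>m p - ?H * ?H\<^sup>T) $$ (i, j) = mat p p (\<lambda>(i, j). ?K (vs ! i) (vs ! j)) $$ (i, j)"
      using ij by (simp add: incidence_mat_def scalar_prod_def p_def q_def)
  qed (auto simp: incidence_mat_def p_def)
  have "char_poly (2 \<cdot>\<^sub>m 1\<^sub>m p - ?H * ?H\<^sup>T) = (\<Prod>t\<in>T. [:- (2 - d t), 1:])"
    unfolding HHt unfolding p_def
  proof (rule char_poly_orthogonal_eigenfunctions[OF vs T _ orth nz])
    fix t u assume tu: "t \<in> T" "u \<in> ?V"
    have "(\<Sum>v\<in>?V. ?K u v * f t v)
        = (\<Sum>v\<in>?V. if u = v then 2 * f t v else 0) - (\<Sum>v\<in>?V. (\<Sum>e\<in>?E. \<eta> u e * \<eta> v e) * f t v)"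
      unfolding sum_subtractf[symmetric] by (rule sum.cong) (auto simp: algebra_simps)
    also have "\<dots> = 2 * f t u - laplacian \<Sigma> (f t) u"
      using fin tu incidence_laplacian[OF S I tu(2), of "f t"] by simp
    finally show "(\<Sum>v\<in>?V. ?K u v * f t v) = (2 - d t) * f t u"
      using eig[OF tu] by (simp add: algebra_simps)
  qed
  \<comment> \<open>Since \<open>q = p + k\<close>, the power of \<open>X - 2\<close> on the vertex
    side splits, and the common \<open>p\<close>-th power can be cancelled.\<close>
  then have "[:-2, 1:] ^ p * char_poly (2 \<cdot>\<^sub>m 1\<^sub>m q - ?H\<^sup>T * ?H)
      = [:-2, 1:] ^ p * ((\<Prod>t\<in>T. [:- (2 - d t), 1:]) * [:-2, 1:] ^ k)"
    using char_poly_diff_mult_commute[of ?H p q "?H\<^sup>T" 2] H by (simp add: pq power_add mult_ac)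
  moreover have "[:-2, 1:] ^ p \<noteq> (0 :: real poly)" by simp
  ultimately have "char_poly (2 \<cdot>\<^sub>m 1\<^sub>m q - ?H\<^sup>T * ?H) = (\<Prod>t\<in>T. [:- (2 - d t), 1:]) * [:-2, 1:] ^ k"
    using mult_left_cancel by blast
  moreover have "(\<Prod>t\<in>T. [:- (2 - d t), 1:]) \<noteq> 0" using T(1) by simp
  moreover have "repeat_mset k {#2::real#} = replicate_mset k 2"
    by (induction k) auto
  ultimately show ?thesis
    unfolding ev using proots_prod_linear[OF T(1), of "\<lambda>t. 2 - d t"] by (simp add: proots_mult proots_power)
qed

subsection \<open>Cartesian products\<close>

lemma cartesian_product_edge_iff:
  "{(a, b), (a', b')} \<in> sg_edges (cartesian_product \<Sigma>\<^sub>1 \<Sigma>\<^sub>2) \<longleftrightarrow>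
     {a, a'} \<in> sg_edges \<Sigma>\<^sub>1 \<and> b = b' \<and> b \<in> sg_verts \<Sigma>\<^sub>2
     \<or> a = a' \<and> a \<in> sg_verts \<Sigma>\<^sub>1 \<and> {b, b'} \<in> sg_edges \<Sigma>\<^sub>2"
    (is "?l \<longleftrightarrow> ?r")
proof
  assume ?l
  then consider
      u u' v where "{(a, b), (a', b')} = {(u, v), (u', v)}" "{u, u'} \<in> sg_edges \<Sigma>\<^sub>1" "v \<in> sg_verts \<Sigma>\<^sub>2"
    | u v v' where "{(a, b), (a', b')} = {(u, v), (u, v')}" "u \<in> sg_verts \<Sigma>\<^sub>1" "{v, v'} \<in> sg_edges \<Sigma>\<^sub>2"
    unfolding cartesian_product_def by auto
  then show ?r by cases (auto simp: doubleton_eq_iff insert_commute)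
next
  assume ?r
  then show ?l unfolding cartesian_product_def by auto
qed

text \<open>The neighbours of \<open>(a, b)\<close> fall into a copy of those of \<open>a\<close>
  and a copy of those of \<open>b\<close>. Along the first copy \<open>g b\<close> is a constant
  factor, along the second \<open>f a\<close> is.\<close>

lemma laplacian_cartesian_product:
  assumes S: "signed_graph \<Sigma>\<^sub>1" "signed_graph \<Sigma>\<^sub>2"
    and ab: "a \<in> sg_verts \<Sigma>\<^sub>1" "b \<in> sg_verts \<Sigma>\<^sub>2"
  shows "laplacian (cartesian_product \<Sigma>\<^sub>1 \<Sigma>\<^sub>2) (\<lambda>(u, v). f u * g v) (a, b)
    = laplacian \<Sigma>\<^sub>1 f a * g b + f a * laplacian \<Sigma>\<^sub>2 g b"
proof -
  let ?P = "cartesian_product \<Sigma>\<^sub>1 \<Sigma>\<^sub>2"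
  let ?N1 = "{a'. {a, a'} \<in> sg_edges \<Sigma>\<^sub>1}" and ?N2 = "{b'. {b, b'} \<in> sg_edges \<Sigma>\<^sub>2}"
  let ?h = "\<lambda>w. f a * g b - sg_sign ?P {(a, b), w} * (case w of (u, v) \<Rightarrow> f u * g v)"
  have N: "{w. {(a, b), w} \<in> sg_edges ?P} = (\<lambda>a'. (a', b)) ` ?N1 \<union> (\<lambda>b'. (a, b')) ` ?N2"
    using ab by (auto simp: cartesian_product_edge_iff)
  have fin: "finite ?N1" "finite ?N2"
    using S signed_graph_edgeD by (auto simp: signed_graph_def intro!: finite_subset[of ?N1 "sg_verts \<Sigma>\<^sub>1"]
        finite_subset[of ?N2 "sg_verts \<Sigma>\<^sub>2"])
  \<comment> \<open>A common element could only be \<open>(a, b)\<close> itself, which would need a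
    loop at \<open>a\<close>.\<close>
  have disj: "(\<lambda>a'. (a', b)) ` ?N1 \<inter> (\<lambda>b'. (a, b')) ` ?N2 = {}"
    using signed_graph_edgeD(3)[OF S(1), of a a] by auto
  have "laplacian ?P (\<lambda>(u, v). f u * g v) (a, b)
      = (\<Sum>w \<in> (\<lambda>a'. (a', b)) ` ?N1 \<union> (\<lambda>b'. (a, b')) ` ?N2. ?h w)"
    unfolding laplacian_def N by simp
  also have "\<dots> = (\<Sum>a'\<in>?N1. ?h (a', b)) + (\<Sum>b'\<in>?N2. ?h (a, b'))"
    using fin disj by (subst sum.union_disjoint) (auto simp: sum.reindex inj_on_def)
  also have "(\<Sum>a'\<in>?N1. ?h (a', b)) = laplacian \<Sigma>\<^sub>1 f a * g b"
    unfolding laplacian_def sum_distrib_right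
    by (rule sum.cong) (auto simp: cartesian_product_def algebra_simps)
  \<comment> \<open>Here \<open>b \<noteq> b'\<close>, so the projection of the edge is not a
    singleton and its sign is read off in the second factor.\<close>
  also have "(\<Sum>b'\<in>?N2. ?h (a, b')) = f a * laplacian \<Sigma>\<^sub>2 g b"
    unfolding laplacian_def sum_distrib_left
    using signed_graph_edgeD(3)[OF S(2), of b]
    by (intro sum.cong) (auto simp: cartesian_product_def is_singleton_altdef algebra_simps)
  finally show ?thesis .
qed

text \<open>Written as \<open>e \<times> {v}\<close> and \<open>{u} \<times> e\<close>, the edges
  form two injective images of \<open>?E1 \<times> ?V2\<close> and
  \<open>?V1 \<times> ?E2\<close>.\<close>

lemma card_edges_cartesian_product:
  assumes S: "signed_graph \<Sigma>\<^sub>1" "signed_graph \<Sigma>\<^sub>2"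
  shows "card (sg_edges (cartesian_product \<Sigma>\<^sub>1 \<Sigma>\<^sub>2))
    = card (sg_edges \<Sigma>\<^sub>1) * card (sg_verts \<Sigma>\<^sub>2) + card (sg_verts \<Sigma>\<^sub>1) * card (sg_edges \<Sigma>\<^sub>2)"
proof -
  let ?V1 = "sg_verts \<Sigma>\<^sub>1" and ?V2 = "sg_verts \<Sigma>\<^sub>2" and ?E1 = "sg_edges \<Sigma>\<^sub>1" and ?E2 = "sg_edges \<Sigma>\<^sub>2"
  let ?F1 = "(\<lambda>(e, v). e \<times> {v}) ` (?E1 \<times> ?V2)" and ?F2 = "(\<lambda>(u, e). {u} \<times> e) ` (?V1 \<times> ?E2)"
  have ne2: "e \<noteq> {}" if "e \<in> ?E2" for e using signed_graph_edge_doubleton[OF S(2) that] by blast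
  have ne1: "e \<noteq> {}" if "e \<in> ?E1" for e using signed_graph_edge_doubleton[OF S(1) that] by blast
  have "{{(u, v), (u', v)} | u u' v. {u, u'} \<in> ?E1 \<and> v \<in> ?V2} = ?F1"
  proof (intro equalityI subsetI)
    fix s assume "s \<in> {{(u, v), (u', v)} | u u' v. {u, u'} \<in> ?E1 \<and> v \<in> ?V2}"
    then obtain u u' v where "s = {u, u'} \<times> {v}" "{u, u'} \<in> ?E1" "v \<in> ?V2" by auto
    then show "s \<in> ?F1" by (intro image_eqI[of _ _ "({u, u'}, v)"]) simp_all
  next
    fix s assume "s \<in> ?F1"
    then obtain e v where s: "s = e \<times> {v}" "e \<in> ?E1" "v \<in> ?V2" by auto
    moreover obtain x y where "e = {x, y}" using signed_graph_edge_doubleton[OF S(1) s(2)] by blast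
    ultimately have "s = {(x, v), (y, v)}" "{x, y} \<in> ?E1" "v \<in> ?V2" by auto
    then show "s \<in> {{(u, v), (u', v)} | u u' v. {u, u'} \<in> ?E1 \<and> v \<in> ?V2}" by blast
  qed
  moreover have "{{(u, v), (u, v')} | u v v'. u \<in> ?V1 \<and> {v, v'} \<in> ?E2} = ?F2"
  proof (intro equalityI subsetI)
    fix s assume "s \<in> {{(u, v), (u, v')} | u v v'. u \<in> ?V1 \<and> {v, v'} \<in> ?E2}"
    then obtain u v v' where "s = {u} \<times> {v, v'}" "u \<in> ?V1" "{v, v'} \<in> ?E2" by auto
    then show "s \<in> ?F2" by (intro image_eqI[of _ _ "(u, {v, v'})"]) simp_all
  next
    fix s assume "s \<in> ?F2"
    then obtain u e where s: "s = {u} \<times> e" "u \<in> ?V1" "e \<in> ?E2" by auto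
    moreover obtain x y where "e = {x, y}" using signed_graph_edge_doubleton[OF S(2) s(3)] by blast
    ultimately have "s = {(u, x), (u, y)}" "u \<in> ?V1" "{x, y} \<in> ?E2" by auto
    then show "s \<in> {{(u, v), (u, v')} | u v v'. u \<in> ?V1 \<and> {v, v'} \<in> ?E2}" by blast
  qed
  ultimately have E: "sg_edges (cartesian_product \<Sigma>\<^sub>1 \<Sigma>\<^sub>2) = ?F1 \<union> ?F2"
    by (simp add: cartesian_product_def)
  have disj: "?F1 \<inter> ?F2 = {}"
  proof -
    \<comment> \<open>A set of both forms would force the two-element set \<open>e\<close> into the
      singleton \<open>{u}\<close>.\<close>
    have False if "e \<times> {v} = {u} \<times> e'" "e \<in> ?E1" "e' \<in> ?E2" for e v u e'
    proof -
      have "e \<subseteq> {u}" using that(1) ne2[OF that(3)] by blast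
      then have "card e \<le> 1" using card_mono[of "{u}" e] by simp
      then show False using S(1) that(2) by (simp add: signed_graph_def)
    qed
    then show ?thesis by fastforce
  qed
  have "inj_on (\<lambda>(e, v). e \<times> {v}) (?E1 \<times> ?V2)"
    using ne1 by (auto simp: inj_on_def times_eq_iff)
  moreover have "inj_on (\<lambda>(u, e). {u} \<times> e) (?V1 \<times> ?E2)"
    using ne2 by (auto simp: inj_on_def times_eq_iff)
  moreover have "finite ?V1" "finite ?V2" "finite ?E1" "finite ?E2"
    using S finite_sg_edges by (auto simp: signed_graph_def)
  ultimately show ?thesis
    unfolding E using disj by (subst card_Un_disjoint) (auto simp: card_image card_cartesian_product)
qed

text \<open>Inner products of the functions \<open>f\<^sub>1 s u * f\<^sub>2 t v\<close> factor, so
  they vanish exactly if one factor does, that is, if the index pairs differ in some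
  component.\<close>

lemma laplacian_eigenbasis_cartesian_product:
  assumes S: "signed_graph \<Sigma>\<^sub>1" "signed_graph \<Sigma>\<^sub>2"
    and B: "laplacian_eigenbasis \<Sigma>\<^sub>1 T\<^sub>1 d\<^sub>1 f\<^sub>1" "laplacian_eigenbasis \<Sigma>\<^sub>2 T\<^sub>2 d\<^sub>2 f\<^sub>2"
  shows "laplacian_eigenbasis (cartesian_product \<Sigma>\<^sub>1 \<Sigma>\<^sub>2) (T\<^sub>1 \<times> T\<^sub>2)
    (\<lambda>(s, t). d\<^sub>1 s + d\<^sub>2 t) (\<lambda>(s, t) (u, v). f\<^sub>1 s u * f\<^sub>2 t v)"
proof -
  have "(\<Sum>(u, v)\<in>sg_verts \<Sigma>\<^sub>1 \<times> sg_verts \<Sigma>\<^sub>2. (f\<^sub>1 s u * f\<^sub>2 t v) * (f\<^sub>1 s' u * f\<^sub>2 t' v))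
      = (\<Sum>u\<in>sg_verts \<Sigma>\<^sub>1. f\<^sub>1 s u * f\<^sub>1 s' u) * (\<Sum>v\<in>sg_verts \<Sigma>\<^sub>2. f\<^sub>2 t v * f\<^sub>2 t' v)" for s t s' t'
    unfolding sum_product sum.cartesian_product by (rule sum.cong) (auto simp: mult_ac)
  moreover have "laplacian (cartesian_product \<Sigma>\<^sub>1 \<Sigma>\<^sub>2) (\<lambda>(u, v). f\<^sub>1 s u * f\<^sub>2 t v) (a, b)
      = (d\<^sub>1 s + d\<^sub>2 t) * (f\<^sub>1 s a * f\<^sub>2 t b)"
    if "s \<in> T\<^sub>1" "t \<in> T\<^sub>2" "a \<in> sg_verts \<Sigma>\<^sub>1" "b \<in> sg_verts \<Sigma>\<^sub>2" for s t a b
    using that B unfolding laplacian_eigenbasis_def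
    by (simp add: laplacian_cartesian_product[OF S] algebra_simps)
  moreover have "sg_verts (cartesian_product \<Sigma>\<^sub>1 \<Sigma>\<^sub>2) = sg_verts \<Sigma>\<^sub>1 \<times> sg_verts \<Sigma>\<^sub>2"
    by (simp add: cartesian_product_def)
  ultimately show ?thesis
    using B unfolding laplacian_eigenbasis_def
    by (auto simp: card_cartesian_product split_def)
qed

text \<open>For a cycle this product is the sign left on the closing edge after switching; through
  it the spectrum depends only on the parity of the number of negative edges.\<close>

lemma prod_signs:
  assumes S: "signed_graph \<Sigma>"
  shows "(\<Prod>e\<in>sg_edges \<Sigma>. sg_sign \<Sigma> e) = (-1) ^ card (negative_edges \<Sigma>)"
proof -
  have "(\<Prod>e\<in>sg_edges \<Sigma>. sg_sign \<Sigma> e) = (\<Prod>e\<in>sg_edges \<Sigma>. if e \<in> negative_edges \<Sigma> then -1 else 1)"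
    using S by (intro prod.cong) (auto simp: signed_graph_def negative_edges_def)
  also have "\<dots> = (\<Prod>e\<in>sg_edges \<Sigma> \<inter> negative_edges \<Sigma>. -1)"
    by (subst prod.inter_restrict) (use finite_sg_edges[OF S] in auto)
  also have "sg_edges \<Sigma> \<inter> negative_edges \<Sigma> = negative_edges \<Sigma>" by (auto simp: negative_edges_def)
  finally show ?thesis by simp
qed

text \<open>Lets the bases of paths and cycles be given as functions \<open>x t k\<close> of the
  position \<open>k\<close>; they are carried over to the vertices by inverting the
  enumeration.\<close>

lemma laplacian_eigenbasis_listI:
  assumes S: "signed_graph \<Sigma>" and vs: "enumerates vs (sg_verts \<Sigma>)"
    and T: "finite T" "card T = length vs"
    and eig: "\<And>t k. t \<in> T \<Longrightarrow> k < length vs \<Longrightarrow>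
      (\<Sum>l | l < length vs \<and> {vs ! k, vs ! l} \<in> sg_edges \<Sigma>. x t k - sg_sign \<Sigma> {vs ! k, vs ! l} * x t l)
        = d t * x t k"
    and orth: "\<And>s t. s \<in> T \<Longrightarrow> t \<in> T \<Longrightarrow> (\<Sum>k<length vs. x s k * x t k) = 0 \<longleftrightarrow> s \<noteq> t"
  shows "\<exists>f. laplacian_eigenbasis \<Sigma> T d f"
proof -
  have dvs: "distinct vs" "set vs = sg_verts \<Sigma>" using vs by (auto simp: enumerates_def)
  have bij: "bij_betw ((!) vs) {..<length vs} (sg_verts \<Sigma>)"
    using dvs by (intro bij_betw_nth) auto
  define f where "f t v = x t (the_inv_into {..<length vs} ((!) vs) v)" for t v
  have f: "f t (vs ! k) = x t k" if "k < length vs" for t k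
    unfolding f_def using the_inv_into_f_f[OF bij_betw_imp_inj_on[OF bij], of k] that by simp
  have "laplacian \<Sigma> (f t) u = d t * f t u" if tu: "t \<in> T" "u \<in> sg_verts \<Sigma>" for t u
  proof -
    obtain k where k: "k < length vs" "u = vs ! k" using tu dvs by (metis in_set_conv_nth)
    have "bij_betw ((!) vs) {l. l < length vs \<and> {u, vs ! l} \<in> sg_edges \<Sigma>} {w. {u, w} \<in> sg_edges \<Sigma>}"
    proof (rule bij_betw_imageI)
      show "inj_on ((!) vs) {l. l < length vs \<and> {u, vs ! l} \<in> sg_edges \<Sigma>}"
        by (rule inj_on_subset[OF bij_betw_imp_inj_on[OF bij]]) auto
      have "w \<in> set vs" if "{u, w} \<in> sg_edges \<Sigma>" for w
        using signed_graph_edgeD(2)[OF S that] dvs by simp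
      then show "(!) vs ` {l. l < length vs \<and> {u, vs ! l} \<in> sg_edges \<Sigma>} = {w. {u, w} \<in> sg_edges \<Sigma>}"
        by (fastforce simp: in_set_conv_nth)
    qed
    then have "laplacian \<Sigma> (f t) u
        = (\<Sum>l | l < length vs \<and> {u, vs ! l} \<in> sg_edges \<Sigma>. f t u - sg_sign \<Sigma> {u, vs ! l} * f t (vs ! l))"
      unfolding laplacian_def by (rule sum.reindex_bij_betw[symmetric])
    also have "\<dots> = d t * f t u"
      unfolding k using eig[OF tu(1) k(1)] k(1) by (simp add: f)
    finally show ?thesis .
  qed
  moreover have "(\<Sum>v\<in>sg_verts \<Sigma>. f s v * f t v) = (\<Sum>k<length vs. x s k * x t k)" for s t
    unfolding sum.reindex_bij_betw[OF bij, of "\<lambda>v. f s v * f t v", symmetric] by (simp add: f)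
  moreover have "card (sg_verts \<Sigma>) = length vs" using dvs distinct_card by metis
  ultimately show ?thesis
    using T orth unfolding laplacian_eigenbasis_def by (intro exI[of _ f]) auto
qed

subsection \<open>Signed paths and cycles\<close>

text \<open>Telescoping: multiplied by \<open>2 * sin \<psi>\<close>, each summand is a difference
  of sines at consecutive even multiples of \<open>\<psi>\<close>.\<close>

lemma sum_cos_odd_multiples:
  "2 * sin \<psi> * (\<Sum>k<n. cos (\<psi> * (2 * real k + 1))) = sin (2 * real n * \<psi>)"
proof (induction n)
  case (Suc n)
  have "2 * sin \<psi> * cos (\<psi> * (2 * real n + 1)) = sin (2 * real (Suc n) * \<psi>) - sin (2 * real n * \<psi>)"
    using sin_diff_sin[of "2 * real (Suc n) * \<psi>" "2 * real n * \<psi>"] by (simp add: algebra_simps add_divide_distrib)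
  with Suc show ?case by (simp add: algebra_simps)
qed simp

text \<open>Telescoping again, now with the half angle; the sum of sines below is treated in the
  same way.\<close>

lemma sum_cos_multiples:
  "2 * sin (\<psi> / 2) * (\<Sum>k<m. cos (\<psi> * real k)) = sin (real m * \<psi> - \<psi> / 2) + sin (\<psi> / 2)"
proof (induction m)
  case (Suc m)
  have "2 * sin (\<psi> / 2) * cos (\<psi> * real m) = sin (real (Suc m) * \<psi> - \<psi> / 2) - sin (real m * \<psi> - \<psi> / 2)"
    using sin_diff_sin[of "real (Suc m) * \<psi> - \<psi> / 2" "real m * \<psi> - \<psi> / 2"]
    by (simp add: algebra_simps add_divide_distrib)
  with Suc show ?case by (simp add: algebra_simps)
qed simp

lemma sum_sin_multiples:
  "2 * sin (\<psi> / 2) * (\<Sum>k<m. sin (\<psi> * real k)) = cos (\<psi> / 2) - cos (real m * \<psi> - \<psi> / 2)"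
proof (induction m)
  case (Suc m)
  have "2 * sin (\<psi> / 2) * sin (\<psi> * real m) = cos (real m * \<psi> - \<psi> / 2) - cos (real (Suc m) * \<psi> - \<psi> / 2)"
    using cos_diff_cos[of "real m * \<psi> - \<psi> / 2" "real (Suc m) * \<psi> - \<psi> / 2"]
    by (simp add: algebra_simps add_divide_distrib)
  with Suc show ?case by (simp add: algebra_simps)
qed simp

text \<open>A zero would make \<open>a\<close> a multiple of \<open>n\<close>. This ensures that the
  sine factors in the telescoped identities can be cancelled.\<close>

lemma sin_int_pi_neq_0:
  fixes a :: int
  assumes "a \<noteq> 0" "\<bar>a\<bar> < int n"
  shows "sin (of_int a * pi / real n) \<noteq> 0"
proof
  assume "sin (of_int a * pi / real n) = 0"
  then obtain b :: int where b: "of_int a * pi / real n = of_int b * pi"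
    by (auto simp: sin_zero_iff_int2)
  have "n > 0" using assms by auto
  with b have "of_int a = (of_int b * real n :: real)" by (simp add: field_simps)
  then have "a = b * int n" by (metis of_int_eq_iff of_int_mult of_int_of_nat_eq)
  with assms show False by (auto simp: abs_mult)
qed

text \<open>For \<open>i \<noteq> j\<close> the product formula for cosines leaves two sums over odd
  multiples of an angle, each of which telescopes to 0. For \<open>i = j\<close> the sum consists of
  squares, and the one at \<open>k = 0\<close> is positive because the angle lies in
  \<open>[0, pi / 2)\<close>.\<close>

lemma path_basis_orthogonal:
  assumes ij: "i \<in> {1..n}" "j \<in> {1..n}"
  shows "(\<Sum>k<n. cos ((real n - real i) * pi / (2 * real n) * (2 * real k + 1))
               * cos ((real n - real j) * pi / (2 * real n) * (2 * real k + 1))) = 0 \<longleftrightarrow> i \<noteq> j"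
proof -
  let ?\<theta> = "\<lambda>i. (real n - real i) * pi / (2 * real n)"
  have n: "n > 0" using ij by auto
  have zero: "(\<Sum>k<n. cos (of_int a * pi / (2 * real n) * (2 * real k + 1))) = 0"
    if a: "a \<noteq> 0" "\<bar>a\<bar> < 2 * int n" for a :: int
  proof -
    have "sin (2 * real n * (of_int a * pi / (2 * real n))) = sin (of_int a * pi)" using n by simp
    also have "\<dots> = 0" by (rule sin_zero_iff_int2[THEN iffD2]) blast
    finally have "sin (2 * real n * (of_int a * pi / (2 * real n))) = 0" .
    moreover have "sin (of_int a * pi / (2 * real n)) \<noteq> 0" using sin_int_pi_neq_0[of a "2 * n"] a by simp
    ultimately show ?thesis
      using sum_cos_odd_multiples[of "of_int a * pi / (2 * real n)" n] by simp
  qed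
  show ?thesis
  proof
    assume 0: "(\<Sum>k<n. cos (?\<theta> i * (2 * real k + 1)) * cos (?\<theta> j * (2 * real k + 1))) = 0"
    show "i \<noteq> j"
    proof
      assume "i = j"
      with 0 have "\<forall>k\<in>{..<n}. cos (?\<theta> i * (2 * real k + 1)) * cos (?\<theta> i * (2 * real k + 1)) = 0"
        by (subst (asm) sum_nonneg_eq_0_iff) auto
      then have "cos (?\<theta> i) = 0" using n by force
      moreover have "0 \<le> ?\<theta> i" "?\<theta> i < pi / 2" using ij n by (auto simp: field_simps)
      then have "cos (?\<theta> i) > 0" using pi_gt_zero by (intro cos_gt_zero_pi) linarith+
      ultimately show False by simp
    qed
  next
    assume "i \<noteq> j"
    have "(\<Sum>k<n. cos (?\<theta> i * (2 * real k + 1)) * cos (?\<theta> j * (2 * real k + 1)))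
        = (\<Sum>k<n. cos (of_int (int j - int i) * pi / (2 * real n) * (2 * real k + 1))) / 2
        + (\<Sum>k<n. cos (of_int (2 * int n - int i - int j) * pi / (2 * real n) * (2 * real k + 1))) / 2"
      unfolding sum_divide_distrib sum.distrib[symmetric]
    proof (rule sum.cong[OF refl])
      fix k
      have "of_int (int j - int i) * pi / (2 * real n) * (2 * real k + 1)
            = ?\<theta> i * (2 * real k + 1) - ?\<theta> j * (2 * real k + 1)"
          "of_int (2 * int n - int i - int j) * pi / (2 * real n) * (2 * real k + 1)
            = ?\<theta> i * (2 * real k + 1) + ?\<theta> j * (2 * real k + 1)"
        by (simp_all add: ring_distribs diff_divide_distrib add_divide_distrib)
      then show "cos (?\<theta> i * (2 * real k + 1)) * cos (?\<theta> j * (2 * real k + 1))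
        = cos (of_int (int j - int i) * pi / (2 * real n) * (2 * real k + 1)) / 2
        + cos (of_int (2 * int n - int i - int j) * pi / (2 * real n) * (2 * real k + 1)) / 2"
        by (simp only: cos_times_cos add_divide_distrib)
    qed
    \<comment> \<open>Both integers \<open>j - i\<close> and \<open>2n - i - j\<close> are nonzero
      and less than \<open>2n\<close> in absolute value, as \<open>i\<close> and \<open>j\<close>
      are distinct elements of \<open>{1..n}\<close>.\<close>
    also have "\<dots> = 0"
      using zero[of "int j - int i"] zero[of "2 * int n - int i - int j"] ij \<open>i \<noteq> j\<close> by auto
    finally show "(\<Sum>k<n. cos (?\<theta> i * (2 * real k + 1)) * cos (?\<theta> j * (2 * real k + 1))) = 0" .
  qed
qed

text \<open>
  The kernel of the Hartley transform. Unlike cosines alone, the functions \<open>k \<mapsto> cas (\<theta> k)\<close> form a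
  real orthogonal eigenbasis of the cycle although most of its eigenvalues \<open>2 - 2 cos \<theta>\<close> are double.
\<close>

definition cas :: "real \<Rightarrow> real" where
  "cas y = cos y + sin y"

lemma cas_mult: "cas y * cas z = cos (y - z) + sin (y + z)"
  by (simp add: cas_def cos_diff sin_add algebra_simps)

text \<open>By \<open>cas_mult\<close> the sum splits into cosines of the difference and sines of
  the sum of the angles, both integer multiples of \<open>2 * pi / m\<close>. The sines always
  cancel; the cosines cancel unless \<open>i = j\<close>, where they add up to
  \<open>m\<close>.\<close>

lemma cycle_basis_orthogonal:
  assumes ij: "i \<in> {1..m}" "j \<in> {1..m}"
  shows "(\<Sum>k<m. cas ((2 * real i - par r) * pi / real m * real k)
               * cas ((2 * real j - par r) * pi / real m * real k)) = 0 \<longleftrightarrow> i \<noteq> j"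
proof -
  let ?\<theta> = "\<lambda>i. (2 * real i - par r) * pi / real m"
  have m: "m > 0" using ij by auto
  have period: "real m * (of_int a * (2 * pi) / real m) = of_int a * (2 * pi)" for a :: int
    using m by simp
  have turn: "cos (of_int a * (2 * pi)) = 1" "sin (of_int a * (2 * pi)) = 0" for a :: int
    using cos_int_2pin[of a] sin_int_2pin[of a] by (simp_all add: mult_ac)
  have sin0: "(\<Sum>k<m. sin (of_int a * (2 * pi) / real m * real k)) = 0" for a :: int
  \<comment> \<open>If the factor in the telescoped identity vanishes, the angle is a multiple of
    \<open>2 * pi\<close> and every single summand is 0.\<close>
  proof (cases "sin (of_int a * (2 * pi) / real m / 2) = 0")
    case True
    then obtain b :: int where "of_int a * (2 * pi) / real m / 2 = of_int b * pi"
      by (auto simp: sin_zero_iff_int2)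
    then have b: "of_int a * (2 * pi) / real m = of_int (2 * b) * pi" using m by (simp add: field_simps)
    have "sin (of_int a * (2 * pi) / real m * real k) = 0" for k
      unfolding b by (rule sin_zero_iff_int2[THEN iffD2], rule exI[of _ "2 * b * int k"]) simp
    then show ?thesis by simp
  next
    case False
    have "cos (real m * (of_int a * (2 * pi) / real m) - of_int a * (2 * pi) / real m / 2)
        = cos (of_int a * (2 * pi) / real m / 2)"
      unfolding period by (simp add: cos_diff turn)
    with False sum_sin_multiples[of "of_int a * (2 * pi) / real m" m] show ?thesis by simp
  qed
  have cos0: "(\<Sum>k<m. cos (of_int a * (2 * pi) / real m * real k)) = 0"
    if a: "a \<noteq> 0" "\<bar>a\<bar> < int m" for a :: int
  proof -
    have "sin (real m * (of_int a * (2 * pi) / real m) - of_int a * (2 * pi) / real m / 2)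
        = - sin (of_int a * (2 * pi) / real m / 2)"
      unfolding period by (simp add: sin_diff turn)
    moreover have "sin (of_int a * (2 * pi) / real m / 2) \<noteq> 0" using sin_int_pi_neq_0[of a m] a by simp
    ultimately show ?thesis
      using sum_cos_multiples[of "of_int a * (2 * pi) / real m" m] by simp
  qed
  \<comment> \<open>An integer copy of \<open>par r\<close>, so that the sum of two angles is an
    integer multiple of \<open>2 * pi / m\<close>.\<close>
  obtain e :: int where e: "of_int e = par r" by (metis par_def of_int_0 of_int_1)
  have eq: "(\<Sum>k<m. cas (?\<theta> i * real k) * cas (?\<theta> j * real k))
      = (\<Sum>k<m. cos (of_int (int i - int j) * (2 * pi) / real m * real k))
      + (\<Sum>k<m. sin (of_int (int i + int j - e) * (2 * pi) / real m * real k))"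
    unfolding sum.distrib[symmetric]
  proof (rule sum.cong[OF refl])
    fix k
    have "of_int (int i - int j) * (2 * pi) / real m * real k = ?\<theta> i * real k - ?\<theta> j * real k"
      "of_int (int i + int j - e) * (2 * pi) / real m * real k = ?\<theta> i * real k + ?\<theta> j * real k"
      by (simp_all add: e ring_distribs diff_divide_distrib add_divide_distrib mult_ac)
    then show "cas (?\<theta> i * real k) * cas (?\<theta> j * real k)
      = cos (of_int (int i - int j) * (2 * pi) / real m * real k)
      + sin (of_int (int i + int j - e) * (2 * pi) / real m * real k)"
      by (simp only: cas_mult)
  qed
  show ?thesis
  proof (cases "i = j")
    case True
    with m show ?thesis unfolding eq sin0 by simp
  next
    case False
    then show ?thesis unfolding eq sin0 using cos0[of "int i - int j"] ij by auto
  qed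
qed

section \<open>Signed paths\<close>

text \<open>After switching, the cosines satisfy a three-term recurrence with factor
  \<open>2 * cos (2 * \<theta> j)\<close>, where \<open>2 * \<theta> j = pi - j * pi / n\<close>;
  this gives the eigenvalue. At either end the missing neighbour does no harm, since the cosine
  continued one step beyond the path repeats its end value.\<close>

lemma signed_path_eigenbasis:
  assumes P: "signed_path n r P"
  shows "\<exists>f. laplacian_eigenbasis P {1..n} (\<lambda>j. 2 + 2 * cos (real j * pi / real n)) f"
proof -
  from P have S: "signed_graph P" by (simp add: signed_path_def)
  from P obtain vs where vs: "enumerates vs (sg_verts P)" "length vs = n"
    and E: "sg_edges P = {{vs ! i, vs ! Suc i} | i. Suc i < n}" unfolding signed_path_def by auto
  have inj: "vs ! k = vs ! l \<longleftrightarrow> k = l" if "k < n" "l < n" for k l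
    using that vs by (simp add: enumerates_def nth_eq_iff_index_eq)
  have adj: "{vs ! k, vs ! l} \<in> sg_edges P \<longleftrightarrow> l = Suc k \<or> k = Suc l" if "k < n" "l < n" for k l
  proof
    assume "{vs ! k, vs ! l} \<in> sg_edges P"
    then obtain i where "{vs ! k, vs ! l} = {vs ! i, vs ! Suc i}" "Suc i < n" unfolding E by auto
    then show "l = Suc k \<or> k = Suc l" using inj that by (auto simp: doubleton_eq_iff)
  next
    assume "l = Suc k \<or> k = Suc l"
    then show "{vs ! k, vs ! l} \<in> sg_edges P" unfolding E using that by (auto simp: insert_commute)
  qed
  define s where "s k = sg_sign P {vs ! k, vs ! Suc k}" for k
  have s: "s k * s k = 1" if "Suc k < n" for k
  proof -
    have "{vs ! k, vs ! Suc k} \<in> sg_edges P" unfolding E using that by auto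
    then have "s k \<in> {1, -1}" using S unfolding signed_graph_def s_def by blast
    then show ?thesis by auto
  qed
  \<comment> \<open>Switching by \<open>\<delta>\<close> makes all edges positive.\<close>
  define \<delta> where "\<delta> k = (\<Prod>i<k. s i)" for k
  have \<delta>: "\<delta> k * \<delta> k = 1" if "k < n" for k
    using that by (induction k) (auto simp: \<delta>_def mult_ac s)
  define \<theta> where "\<theta> j = (real n - real j) * pi / (2 * real n)" for j
  \<comment> \<open>The argument is real so that the positions -1 and \<open>n\<close> just outside
    the path make sense.\<close>
  define c where "c j y = cos (\<theta> j * (2 * y + 1))" for j y
  define x where "x j k = \<delta> k * c j (real k)" for j k
  show ?thesis
  proof (rule laplacian_eigenbasis_listI[OF S vs(1)])
    show "finite {1..n}" "card {1..n} = length vs" using vs by auto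
  next
    fix i j assume ij: "i \<in> {1..n}" "j \<in> {1..n}"
    \<comment> \<open>The switching signs square to 1 and drop out of inner products.\<close>
    have "(\<Sum>k<length vs. x i k * x j k) = (\<Sum>k<n. c i (real k) * c j (real k))"
    proof (unfold vs(2), rule sum.cong[OF refl])
      fix k assume "k \<in> {..<n}"
      then show "x i k * x j k = c i (real k) * c j (real k)"
        using \<delta>[of k] by (simp add: x_def mult.assoc mult.left_commute[of "c i (real k)"] flip: mult.assoc[of "\<delta> k" "\<delta> k"])
    qed
    then show "(\<Sum>k<length vs. x i k * x j k) = 0 \<longleftrightarrow> i \<noteq> j"
      using path_basis_orthogonal[OF ij] by (simp add: c_def \<theta>_def)
  next
    fix j k assume j: "j \<in> {1..n}" and "k < length vs"
    then have k: "k < n" using vs by simp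
    let ?g = "\<lambda>l. x j k - sg_sign P {vs ! k, vs ! l} * x j l"
    have up: "(if Suc k < n then ?g (Suc k) else 0) = \<delta> k * (c j (real k) - c j (real k + 1))"
    proof (cases "Suc k < n")
      case True
      have "s k * \<delta> (Suc k) = \<delta> k" using s[OF True] by (simp add: \<delta>_def mult_ac)
      then have "s k * x j (Suc k) = \<delta> k * c j (real k + 1)"
        by (simp add: x_def add_ac flip: mult.assoc)
      then show ?thesis using True unfolding s_def by (simp add: x_def[of j k] right_diff_distrib)
    next
      case False
      \<comment> \<open>At the last vertex both sides are 0: \<open>2 * n * \<theta> j\<close> is a
        multiple of \<open>pi\<close>, so \<open>c j\<close> is symmetric about
        \<open>n - 1/2\<close>.\<close>
      then have kn: "real k = real n - 1" using k by auto
      have "2 * real n * \<theta> j = of_int (int n - int j) * pi" using k by (simp add: \<theta>_def)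
      then have "sin (2 * real n * \<theta> j) = 0" unfolding sin_zero_iff_int2 by blast
      moreover have "\<theta> j * (2 * real k + 1) = 2 * real n * \<theta> j - \<theta> j"
        "\<theta> j * (2 * (real k + 1) + 1) = 2 * real n * \<theta> j + \<theta> j"
        unfolding kn by (simp_all add: algebra_simps)
      ultimately have "c j (real k) = c j (real k + 1)" unfolding c_def by (simp add: cos_add cos_diff)
      then show ?thesis using False by simp
    qed
    \<comment> \<open>At \<open>k = 0\<close> the right side vanishes because cosine is even, which
      gives equal values of \<open>c j\<close> at 0 and -1.\<close>
    have down: "(if k > 0 then ?g (k - 1) else 0) = \<delta> k * (c j (real k) - c j (real k - 1))"
    proof (cases k)
      case 0
      then show ?thesis by (simp add: c_def)
    next
      case (Suc k')
      have "s k' * \<delta> k' = \<delta> k" by (simp add: \<delta>_def Suc mult_ac)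
      then have "s k' * x j k' = \<delta> k * c j (real k - 1)"
        using Suc by (simp add: x_def flip: mult.assoc)
      then show ?thesis
        using Suc unfolding s_def by (simp add: x_def[of j "Suc k'"] right_diff_distrib insert_commute add_ac)
    qed
    have "{l. l < n \<and> {vs ! k, vs ! l} \<in> sg_edges P} = {l. l < n \<and> (l = Suc k \<or> k = Suc l)}"
      using adj[OF k] by blast
    also have "\<dots> = (if Suc k < n then {Suc k} else {}) \<union> (if k > 0 then {k - 1} else {})"
      using k by auto
    finally have nb: "{l. l < n \<and> {vs ! k, vs ! l} \<in> sg_edges P} = \<dots>" .
    have "(\<Sum>l | l < n \<and> {vs ! k, vs ! l} \<in> sg_edges P. ?g l)
        = (if Suc k < n then ?g (Suc k) else 0) + (if k > 0 then ?g (k - 1) else 0)"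
      unfolding nb by (subst sum.union_disjoint) auto
    also have "\<dots> = \<delta> k * (2 * c j (real k) - (c j (real k + 1) + c j (real k - 1)))"
      unfolding up down by (simp add: algebra_simps)
    also have "c j (real k + 1) + c j (real k - 1) = 2 * cos (2 * \<theta> j) * c j (real k)"
      using cos_times_cos[of "2 * \<theta> j" "\<theta> j * (2 * real k + 1)"] cos_minus[of "\<theta> j * (2 * real k + 1) - 2 * \<theta> j"]
      by (simp add: c_def algebra_simps)
    also have "cos (2 * \<theta> j) = - cos (real j * pi / real n)"
    proof -
      have "2 * \<theta> j = pi - real j * pi / real n" using k by (simp add: \<theta>_def field_simps)
      then show ?thesis by simp
    qed
    finally show "(\<Sum>l | l < length vs \<and> {vs ! k, vs ! l} \<in> sg_edges P. ?g l)
        = (2 + 2 * cos (real j * pi / real n)) * x j k"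
      unfolding vs(2) by (simp add: x_def algebra_simps)
  qed
qed

lemma signed_path_card:
  assumes P: "signed_path n r P"
  shows "card (sg_verts P) = n" "card (sg_edges P) = n - 1"
proof -
  from P obtain vs where vs: "enumerates vs (sg_verts P)" "length vs = n"
    and E: "sg_edges P = {{vs ! i, vs ! Suc i} | i. Suc i < n}" unfolding signed_path_def by auto
  show "card (sg_verts P) = n" using vs distinct_card unfolding enumerates_def by metis
  have "sg_edges P = (\<lambda>i. {vs ! i, vs ! Suc i}) ` {..<n - 1}" unfolding E by auto
  moreover have "inj_on (\<lambda>i. {vs ! i, vs ! Suc i}) {..<n - 1}"
    using vs by (auto simp: inj_on_def doubleton_eq_iff enumerates_def nth_eq_iff_index_eq)
  ultimately show "card (sg_edges P) = n - 1" by (simp add: card_image)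
qed

section \<open>Signed cycles\<close>

context
  fixes m :: nat and C :: "'a sgraph" and vs :: "'a list"
  assumes m: "m \<ge> 3" and S: "signed_graph C" and vs: "enumerates vs (sg_verts C)" "length vs = m"
    and E: "sg_edges C = {{vs ! i, vs ! (Suc i mod m)} | i. i < m}"
begin

lemma cycle_nth_eq_iff: "k < m \<Longrightarrow> l < m \<Longrightarrow> vs ! k = vs ! l \<longleftrightarrow> k = l"
  using vs by (simp add: enumerates_def nth_eq_iff_index_eq)

text \<open>Two indices with the same edge but exchanged endpoints would mean returning to the start
  after two steps, which \<open>m \<ge> 3\<close> excludes.\<close>

lemma bij_betw_cycle_edges: "bij_betw (\<lambda>i. {vs ! i, vs ! (Suc i mod m)}) {..<m} (sg_edges C)"
proof (rule bij_betw_imageI)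
  show "inj_on (\<lambda>i. {vs ! i, vs ! (Suc i mod m)}) {..<m}"
  proof (rule inj_onI)
    fix i j assume ij: "i \<in> {..<m}" "j \<in> {..<m}"
      and eq: "{vs ! i, vs ! (Suc i mod m)} = {vs ! j, vs ! (Suc j mod m)}"
    have "i = j \<or> i = Suc j mod m \<and> Suc i mod m = j"
      using eq ij m by (auto simp: doubleton_eq_iff cycle_nth_eq_iff)
    then show "i = j" using ij m by (auto simp: mod_Suc split: if_splits)
  qed
  show "(\<lambda>i. {vs ! i, vs ! (Suc i mod m)}) ` {..<m} = sg_edges C" unfolding E by auto
qed

lemma cycle_adjacent_iff:
  assumes "k < m" "l < m"
  shows "{vs ! k, vs ! l} \<in> sg_edges C \<longleftrightarrow> l = Suc k mod m \<or> k = Suc l mod m"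
proof
  assume "{vs ! k, vs ! l} \<in> sg_edges C"
  then obtain i where "{vs ! k, vs ! l} = {vs ! i, vs ! (Suc i mod m)}" "i < m" unfolding E by auto
  then show "l = Suc k mod m \<or> k = Suc l mod m"
    using assms m by (auto simp: doubleton_eq_iff cycle_nth_eq_iff)
next
  assume "l = Suc k mod m \<or> k = Suc l mod m"
  then show "{vs ! k, vs ! l} \<in> sg_edges C" unfolding E using assms by (auto simp: insert_commute)
qed

text \<open>The sign \<open>(-1) ^ r\<close> of the closing edge after switching is absorbed by the
  choice of angle: \<open>m * \<theta> i\<close> is \<open>2 * pi * i\<close> minus
  \<open>par r * pi\<close>, so \<open>c i\<close> is periodic or antiperiodic modulo
  \<open>m\<close> as \<open>r\<close> is even or odd.\<close>

lemma cycle_eigenbasis: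
  assumes r: "card (negative_edges C) = r"
  shows "\<exists>f. laplacian_eigenbasis C {1..m} (\<lambda>i. 2 - 2 * cos ((2 * real i - par r) * pi / real m)) f"
proof -
  define s where "s k = sg_sign C {vs ! k, vs ! (Suc k mod m)}" for k
  have s: "s k * s k = 1" if "k < m" for k
  proof -
    have "{vs ! k, vs ! (Suc k mod m)} \<in> sg_edges C" unfolding E using that by auto
    then have "s k \<in> {1, -1}" using S unfolding signed_graph_def s_def by blast
    then show ?thesis by auto
  qed
  \<comment> \<open>Switching by \<open>\<delta>\<close> makes all edges positive except the closing one, which gets the sign \<open>(-1) ^ r\<close>.\<close>
  define \<delta> where "\<delta> k = (\<Prod>i<k. s i)" for k
  have \<delta>: "\<delta> k * \<delta> k = 1" if "k < m" for k
    using that by (induction k) (auto simp: \<delta>_def mult_ac s)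
  \<comment> \<open>The position \<open>m\<close> lies beyond the last vertex;
    \<open>\<delta> m\<close> is the product of all edge signs.\<close>
  have \<delta>m: "\<delta> m = (-1) ^ r"
    using prod.reindex_bij_betw[OF bij_betw_cycle_edges, of "sg_sign C"] prod_signs[OF S] r
    by (simp add: \<delta>_def s_def)
  have \<delta>_Suc: "\<delta> (Suc k) = \<delta> k * s k" for k by (simp add: \<delta>_def)
  have \<delta>_pred: "s k * \<delta> (Suc k) = \<delta> k" if "k < m" for k
    using s[OF that] by (simp add: \<delta>_Suc mult_ac)
  define \<theta> where "\<theta> i = (2 * real i - par r) * pi / real m" for i
  define c where "c i y = cas (\<theta> i * y)" for i y
  define x where "x i k = \<delta> k * c i (real k)" for i k
  have period: "c i (y + real m) = (-1) ^ r * c i y" for i y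
  proof -
    have "\<theta> i * (y + real m) = \<theta> i * y - par r * pi + real i * (2 * pi)"
      using m by (simp add: \<theta>_def field_simps)
    moreover have "cos (real i * (2 * pi)) = 1" "sin (real i * (2 * pi)) = 0"
      using cos_int_2pin[of "int i"] sin_int_2pin[of "int i"] by (simp_all add: mult_ac)
    ultimately show ?thesis
      by (cases "even r") (simp_all add: c_def cas_def par_def sin_add cos_add cos_diff sin_diff)
  qed
  show ?thesis
  proof (rule laplacian_eigenbasis_listI[OF S vs(1)])
    show "finite {1..m}" "card {1..m} = length vs" using vs by auto
  next
    fix i j assume ij: "i \<in> {1..m}" "j \<in> {1..m}"
    have "(\<Sum>k<length vs. x i k * x j k) = (\<Sum>k<m. c i (real k) * c j (real k))"
    proof (unfold vs(2), rule sum.cong[OF refl])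
      fix k assume "k \<in> {..<m}"
      then show "x i k * x j k = c i (real k) * c j (real k)"
        using \<delta>[of k] by (simp add: x_def mult.assoc mult.left_commute[of "c i (real k)"] flip: mult.assoc[of "\<delta> k" "\<delta> k"])
    qed
    then show "(\<Sum>k<length vs. x i k * x j k) = 0 \<longleftrightarrow> i \<noteq> j"
      using cycle_basis_orthogonal[OF ij] by (simp add: c_def \<theta>_def)
  next
    fix i k assume i: "i \<in> {1..m}" and "k < length vs"
    then have k: "k < m" using vs by simp
    let ?g = "\<lambda>l. x i k - sg_sign C {vs ! k, vs ! l} * x i l"
    \<comment> \<open>The cyclic predecessor of \<open>k\<close>.\<close>
    define k' where "k' = (if k = 0 then m - 1 else k - 1)"
    have k': "k' < m" "Suc k' mod m = k" using k by (auto simp: k'_def)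
    have up: "s k * x i (Suc k mod m) = \<delta> k * c i (real k + 1)"
    proof (cases "Suc k < m")
      case True
      then show ?thesis using \<delta>_pred[OF k] by (simp add: x_def add_ac flip: mult.assoc)
    next
      case False
      \<comment> \<open>The successor wraps around to 0, and the sign \<open>(-1) ^ r\<close> from
        \<open>period\<close> cancels the one in \<open>s k = \<delta> k * (-1) ^ r\<close>.\<close>
      then have km: "Suc k = m" using k by simp
      have "c i (real k + 1) = (-1) ^ r * c i 0" using period[of i 0] km by (simp add: add_ac flip: of_nat_Suc)
      moreover have "s k = \<delta> k * (-1) ^ r"
        using \<delta>_Suc[of k] \<delta>m km \<delta>[OF k] by (metis mult.assoc mult_1)
      ultimately show ?thesis unfolding km by (simp add: x_def \<delta>_def)
    qed
    have down: "s k' * x i k' = \<delta> k * c i (real k - 1)"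
    proof (cases k)
      case 0
      have "c i (real k') = (-1) ^ r * c i (- 1)" using period[of i "- 1"] m 0 by (simp add: k'_def)
      moreover have "s k' * \<delta> k' = (-1) ^ r" using \<delta>_Suc[of k'] \<delta>m 0 m by (simp add: k'_def mult.commute)
      ultimately have "s k' * x i k' = c i (- 1)" by (simp add: x_def flip: mult.assoc)
      then show ?thesis using 0 by (simp add: \<delta>_def)
    next
      case (Suc j)
      then have "s k' * \<delta> k' = \<delta> k" using \<delta>_Suc[of j] by (simp add: k'_def mult.commute)
      then show ?thesis using Suc by (simp add: x_def k'_def flip: mult.assoc)
    qed
    \<comment> \<open>Successor and predecessor differ because \<open>m \<ge> 3\<close>.\<close>
    have nb: "{l. l < m \<and> {vs ! k, vs ! l} \<in> sg_edges C} = {Suc k mod m, k'}" "Suc k mod m \<noteq> k'"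
      using cycle_adjacent_iff[OF k] k m by (auto simp: k'_def mod_Suc split: if_splits)
    have "(\<Sum>l | l < m \<and> {vs ! k, vs ! l} \<in> sg_edges C. ?g l)
        = x i k - s k * x i (Suc k mod m) + (x i k - s k' * x i k')"
      unfolding nb(1) using nb(2) k' by (simp add: s_def insert_commute)
    also have "\<dots> = \<delta> k * (2 * c i (real k) - (c i (real k + 1) + c i (real k - 1)))"
      unfolding up down by (simp add: x_def algebra_simps)
    also have "c i (real k + 1) + c i (real k - 1) = 2 * cos (\<theta> i) * c i (real k)"
      by (simp add: c_def cas_def ring_distribs sin_add cos_add sin_diff cos_diff)
    finally show "(\<Sum>l | l < length vs \<and> {vs ! k, vs ! l} \<in> sg_edges C. ?g l)
        = (2 - 2 * cos ((2 * real i - par r) * pi / real m)) * x i k"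
      unfolding vs(2) by (simp add: x_def \<theta>_def algebra_simps)
  qed
qed

end

lemma signed_cycle_eigenbasis:
  assumes "signed_cycle m r C"
  shows "\<exists>f. laplacian_eigenbasis C {1..m} (\<lambda>i. 2 - 2 * cos ((2 * real i - par r) * pi / real m)) f"
proof -
  from assms obtain vs where "m \<ge> 3" "signed_graph C" "enumerates vs (sg_verts C)" "length vs = m"
    "sg_edges C = {{vs ! i, vs ! (Suc i mod m)} | i. i < m}" "card (negative_edges C) = r"
    unfolding signed_cycle_def by auto
  then show ?thesis by (rule cycle_eigenbasis)
qed

lemma signed_cycle_card:
  assumes "signed_cycle m r C"
  shows "card (sg_verts C) = m" "card (sg_edges C) = m"
proof -
  from assms obtain vs where vs: "m \<ge> 3" "signed_graph C" "enumerates vs (sg_verts C)" "length vs = m"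
    "sg_edges C = {{vs ! i, vs ! (Suc i mod m)} | i. i < m}" unfolding signed_cycle_def by auto
  show "card (sg_verts C) = m" using vs distinct_card unfolding enumerates_def by metis
  show "card (sg_edges C) = m" using bij_betw_same_card[OF bij_betw_cycle_edges[OF vs]] by simp
qed

section \<open>Spectrum and energy of the line graph of a cycle times a path\<close>

theorem corollary4p10:
  fixes m n r\<^sub>1 r\<^sub>2 :: nat
    and C :: "'a sgraph" and P :: "'b sgraph"
    and \<eta> :: "'a \<times> 'b \<Rightarrow> ('a \<times> 'b) set \<Rightarrow> real"
  assumes "m \<ge> 3" and "n \<ge> 2" and "r\<^sub>1 \<le> m" and "r\<^sub>2 \<le> n - 1"
    and "signed_cycle m r\<^sub>1 C" and "signed_path n r\<^sub>2 P"
    and "incidence (cartesian_product C P) \<eta>"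
  shows "let ev = (\<lambda>i j. 2 * (cos ((2 * real i - par r\<^sub>1) * pi / real m)
                               - cos (real j * pi / real n) - 1));
             \<Lambda> = line_graph \<eta> (cartesian_product C P)
         in eigenvalues \<Lambda> = {#ev i j. (i, j) \<in># mset_set ({1..m} \<times> {1..n})#}
                              + replicate_mset (m * (n - 1)) 2
            \<and> (\<forall>i\<in>{1..m}. \<forall>j\<in>{1..n}. \<not> (even r\<^sub>1 \<and> i = m \<and> j = n) \<longrightarrow> ev i j < 2)
            \<and> (even r\<^sub>1 \<longrightarrow> ev m n = 2)
            \<and> energy \<Lambda> = 2 * (\<Sum>i=1..m. \<Sum>j=1..n.
                   \<bar>1 - cos ((2 * real i - par r\<^sub>1) * pi / real m) + cos (real j * pi / real n)\<bar>)
                 + 2 * real m * (real n - 1)"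
proof -
  define \<alpha> where "\<alpha> i = (2 * real i - par r\<^sub>1) * pi / real m" for i
  define \<beta> where "\<beta> j = real j * pi / real n" for j
  define ev where "ev i j = 2 * (cos (\<alpha> i) - cos (\<beta> j) - 1)" for i j
  let ?\<Sigma> = "cartesian_product C P"
  have S: "signed_graph C" "signed_graph P"
    using assms(5,6) by (auto simp: signed_cycle_def signed_path_def)
  obtain f where f: "laplacian_eigenbasis C {1..m} (\<lambda>i. 2 - 2 * cos (\<alpha> i)) f"
    using signed_cycle_eigenbasis[OF assms(5)] unfolding \<alpha>_def by blast
  obtain g where g: "laplacian_eigenbasis P {1..n} (\<lambda>j. 2 + 2 * cos (\<beta> j)) g"
    using signed_path_eigenbasis[OF assms(6)] unfolding \<beta>_def by blast
  \<comment> \<open>There are \<open>m * n + m * (n - 1)\<close> edges on \<open>m * n\<close>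
    vertices; the excess is the additional multiplicity of 2.\<close>
  have "card (sg_edges ?\<Sigma>) = card (sg_verts ?\<Sigma>) + m * (n - 1)"
    using signed_cycle_card[OF assms(5)] signed_path_card[OF assms(6)]
    by (simp add: card_edges_cartesian_product[OF S]) (simp add: cartesian_product_def card_cartesian_product)
  from eigenvalues_line_graph[OF signed_graph_cartesian_product[OF S] assms(7)
      laplacian_eigenbasis_cartesian_product[OF S f g] this]
  have eigs: "eigenvalues (line_graph \<eta> ?\<Sigma>)
      = {#ev i j. (i, j) \<in># mset_set ({1..m} \<times> {1..n})#} + replicate_mset (m * (n - 1)) 2"
    by (simp add: ev_def split_def algebra_simps)
  have "energy (line_graph \<eta> ?\<Sigma>) = (\<Sum>i=1..m. \<Sum>j=1..n. \<bar>ev i j\<bar>) + 2 * real m * (real n - 1)"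
    using assms(2) unfolding energy_def eigs sum.cartesian_product
    by (simp add: image_mset.compositionality comp_def split_def sum_unfold_sum_mset)
  also have "(\<Sum>i=1..m. \<Sum>j=1..n. \<bar>ev i j\<bar>)
      = 2 * (\<Sum>i=1..m. \<Sum>j=1..n. \<bar>1 - cos (\<alpha> i) + cos (\<beta> j)\<bar>)"
    unfolding sum_distrib_left by (intro sum.cong) (auto simp: ev_def abs_if)
  finally have en: "energy (line_graph \<eta> ?\<Sigma>) = \<dots> + 2 * real m * (real n - 1)" .
  have "ev m n = 2" if "even r\<^sub>1"
    using that assms(1,2) by (simp add: ev_def \<alpha>_def \<beta>_def par_def)
  moreover have "ev i j < 2" if ij: "i \<in> {1..m}" "j \<in> {1..n}" and ne: "\<not> (even r\<^sub>1 \<and> i = m \<and> j = n)" for i j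
  \<comment> \<open>The value 2 requires both \<open>cos (\<alpha> i) = 1\<close> and
    \<open>cos (\<beta> j) = -1\<close>. For \<open>j < n\<close> the second fails, since
    \<open>\<beta> j\<close> lies in \<open>[0, pi)\<close>; for \<open>j = n\<close> the first has
    to be refuted.\<close>
  proof (cases "j = n")
    case False
    then have "0 \<le> \<beta> j" "\<beta> j < pi" using ij by (auto simp: \<beta>_def field_simps)
    then have "cos (\<beta> j) > -1" using cos_monotone_0_pi[of "\<beta> j" pi] by simp
    then show ?thesis using cos_le_one[of "\<alpha> i"] by (simp add: ev_def del: cos_le_one)
  next
    case True
    have "cos (\<alpha> i) \<noteq> 1"
    proof
      assume "cos (\<alpha> i) = 1"
      then obtain k :: int where "\<alpha> i = real_of_int k * 2 * pi" by (auto simp: cos_one_2pi_int)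
      then have "(2 * real i - par r\<^sub>1) * pi = real_of_int k * 2 * real m * pi"
        using assms(1) by (simp add: \<alpha>_def field_simps)
      then have eq: "2 * real i - par r\<^sub>1 = real_of_int (2 * k * int m)" by simp
      show False
      \<comment> \<open>For even \<open>r\<^sub>1\<close> the equation makes \<open>m\<close> a
        divisor of \<open>i\<close>, hence \<open>i = m\<close>, the excluded pair. For odd
        \<open>r\<^sub>1\<close> it equates an odd and an even integer.\<close>
      proof (cases "even r\<^sub>1")
        case True
        with eq have "real_of_int (int i) = real_of_int (k * int m)" by (simp add: par_def)
        then have "int i = k * int m" by linarith
        then have "m dvd i" by (metis dvd_triv_right int_dvd_int_iff)
        then have "i = m" using ij by (auto dest!: dvd_imp_le)
        with ne True \<open>j = n\<close> show False by simp
      next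
        case False
        with eq have "real_of_int (2 * int i - 1) = real_of_int (2 * k * int m)" by (simp add: par_def)
        then have "2 * int i - 1 = 2 * (k * int m)" by linarith
        then show False by presburger
      qed
    qed
    then have "cos (\<alpha> i) < 1" using cos_le_one[of "\<alpha> i"] by linarith
    then show ?thesis using True ij by (simp add: ev_def \<beta>_def)
  qed
  ultimately show ?thesis
    unfolding Let_def \<alpha>_def[symmetric] \<beta>_def[symmetric] ev_def[symmetric]
    by (intro conjI ballI impI eigs en) blast+
qed

end
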